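(* Let $d,n$ be positive integers, let $K\subset\mathbb{R}^d$ be compact, and let $(f_i)_{i=1}^\infty$ be a family of Lebesgue integrable functions from $K$ to $\mathbb{R}^n$ such that $$\int_K\sup_i\|f_i(x)\|\,dx<\infty.$$ Let $(\bar\theta_i)_{i=1}^\infty$ be a family of measurable functions from $K$ to $[0,+\infty)$ such that $\sum_{i=1}^\infty\bar\theta_i(x)=1$ for all $x\in K$, and set $$\alpha=\int_K\sum_{i=1}^\infty\bar\theta_i(x)f_i(x)\,dx\in\mathbb{R}^n.$$ Let $\mathcal{A}_\alpha$ be the set of all $\theta=(\theta_i)_{i=1}^\infty\in \mathbf{L}^\infty(K,\ell^\infty)$ such that, for a.e. $x\in K$, $\theta_i(x)\ge 0$ for all $i\in\mathbb{N}$ and $\sum_{i=1}^\infty\theta_i(x)=1$, and such that $$\int_K\sum_{i=1}^\infty\theta_i(x)f_i(x)\,dx=\alpha.$$ For $v=(v_i)_{i=1}^\infty\in\mathcal{C}(K,\ell^1)$ consider the problem of minimizing $$\int_K\sum_{i=1}^\infty\theta_i(x)v_i(x)\,dx$$ over $\theta\in\mathcal{A}_\alpha$, and let $\mathcal{V}_\alpha$ be the set of all $v\in\mathcal{C}(K,\ell^1)$ for which this minimization problem has a unique solution. Then $\mathcal{V}_\alpha$ is residual in $\mathcal{C}(K,\ell^1)$, i.e. it contains the intersection of countably many open dense subsets of $\mathcal{C}(K,\ell^1)$. Moreover, for any $v\in\mathcal{V}_\alpha$, the unique optimal solution $\theta^*$ satisfies $\theta^*_i(x)\in\{0,1\}$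 for almost every $x\in K$ and every $i$.
   Context: $\|\cdot\|$ is the norm in $\mathbb{R}^n$. $\ell^\infty$ is the space of bounded real sequences and $\ell^1$ the space of absolutely summable real sequences, with their usual norms. $\mathbf{L}^\infty(K,\ell^\infty)$ is the space of (classes modulo almost everywhere equality of) essentially bounded measurable functions from $K$ to $\ell^\infty$; uniqueness of solutions is understood up to almost everywhere equality. A family $(\bar\theta_i)_{i=1}^\infty$ of measurable functions as in the claim is regarded as an element of this space. $\mathcal{C}(K,\ell^1)$ is the space of continuous functions from $K$ to $\ell^1$ with the supremum norm. Measure and integrals are with respect to Lebesgue measure on $\mathbb{R}^d$. *)

theory Defs
  imports "HOL-Analysis.Analysis"
begin

section \<open>Sequence and function spaces\<close>

definition ell1 :: "(nat \<Rightarrow> real) set"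
  where "ell1 = {a. summable (\<lambda>i. \<bar>a i\<bar>)}"

text \<open>
  The value outside the space is fixed because the library locale for metric spaces
  requires the distance function to be nonnegative and symmetric everywhere.
\<close>

definition ell1_dist :: "(nat \<Rightarrow> real) \<Rightarrow> (nat \<Rightarrow> real) \<Rightarrow> real"
  where "ell1_dist a b = (if a \<in> ell1 \<and> b \<in> ell1 then \<Sum>i. \<bar>a i - b i\<bar> else 0)"

definition ell1_metric :: "(nat \<Rightarrow> real) metric"
  where "ell1_metric = metric (ell1, ell1_dist)"

lemma summable_ell1_diff:
  assumes "a \<in> ell1" "b \<in> ell1"
  shows "summable (\<lambda>i. \<bar>a i - b i\<bar>)"
proof (rule summable_comparison_test')
  show "summable (\<lambda>i. \<bar>a i\<bar> + \<bar>b i\<bar>)"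
    using assms by (simp add: ell1_def summable_add)
  show "norm \<bar>a i - b i\<bar> \<le> \<bar>a i\<bar> + \<bar>b i\<bar>" if "i \<ge> 0" for i
    by simp
qed

lemma Metric_space_ell1: "Metric_space ell1 ell1_dist"
proof
  show "0 \<le> ell1_dist a b" for a b
    by (simp add: ell1_dist_def summable_ell1_diff suminf_nonneg)
  show "ell1_dist a b = ell1_dist b a" for a b
    by (simp add: ell1_dist_def abs_minus_commute conj_commute)
next
  fix a b assume "a \<in> ell1" "b \<in> ell1"
  then show "ell1_dist a b = 0 \<longleftrightarrow> a = b"
    by (auto simp: ell1_dist_def suminf_eq_zero_iff summable_ell1_diff fun_eq_iff)
next
  fix a b c assume *: "a \<in> ell1" "b \<in> ell1" "c \<in> ell1"
  have "(\<Sum>i. \<bar>a i - c i\<bar>) \<le> (\<Sum>i. \<bar>a i - b i\<bar> + \<bar>b i - c i\<bar>)"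
    using * by (intro suminf_le summable_add summable_ell1_diff) auto
  also have "\<dots> = (\<Sum>i. \<bar>a i - b i\<bar>) + (\<Sum>i. \<bar>b i - c i\<bar>)"
    using * by (simp add: suminf_add summable_ell1_diff)
  finally show "ell1_dist a c \<le> ell1_dist a b + ell1_dist b c"
    using * by (simp add: ell1_dist_def)
qed

lemma mspace_ell1_metric [simp]: "mspace ell1_metric = ell1"
  by (simp add: ell1_metric_def Metric_space.mspace_metric Metric_space_ell1)

lemma mdist_ell1_metric [simp]: "mdist ell1_metric = ell1_dist"
  by (simp add: ell1_metric_def Metric_space.mdist_metric Metric_space_ell1)

text \<open>
  The elements of \<open>cfunspace\<close> are extensional functions, so that a continuous function on
  \<open>K\<close> is represented by exactly one element, and its distance is the supremum distance.
\<close>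

definition C_ell1 :: "'a::topological_space set \<Rightarrow> ('a \<Rightarrow> nat \<Rightarrow> real) metric"
  where "C_ell1 K = cfunspace (top_of_set K) ell1_metric"

text \<open>
  As \<open>nat\<close> carries the discrete topology, \<open>nat \<Rightarrow>\<^sub>C real\<close> consists of
  all bounded real sequences, with the supremum norm. The elements below are representatives;
  equality almost everywhere is made explicit where it matters.
\<close>

definition Linf_ellinf :: "'a::euclidean_space set \<Rightarrow> ('a \<Rightarrow> (nat \<Rightarrow>\<^sub>C real)) set"
  where "Linf_ellinf K = {\<theta> \<in> borel_measurable (lebesgue_on K).
           \<exists>B. AE x in lebesgue_on K. norm (\<theta> x) \<le> B}"

definition residual_in :: "'a topology \<Rightarrow> 'a set \<Rightarrow> bool"
  where "residual_in X S \<longleftrightarrow> S \<subseteq> topspace X \<and>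
           (\<exists>\<G>. countable \<G> \<and> (\<forall>U\<in>\<G>. openin X U \<and> X closure_of U = topspace X) \<and>
                topspace X \<inter> \<Inter>\<G> \<subseteq> S)"

section \<open>The minimization problem\<close>

definition admissible ::
    "'a::euclidean_space set \<Rightarrow> (nat \<Rightarrow> 'a \<Rightarrow> 'b::euclidean_space) \<Rightarrow> 'b \<Rightarrow> ('a \<Rightarrow> (nat \<Rightarrow>\<^sub>C real)) set"
  where "admissible K f \<alpha> = {\<theta> \<in> Linf_ellinf K.
           (AE x in lebesgue_on K. (\<forall>i. 0 \<le> \<theta> x i) \<and> (\<lambda>i. \<theta> x i) sums 1) \<and>
           (LINT x|lebesgue_on K. (\<Sum>i. \<theta> x i *\<^sub>R f i x)) = \<alpha>}"

definition cost ::
    "'a::euclidean_space set \<Rightarrow> ('a \<Rightarrow> nat \<Rightarrow> real) \<Rightarrow> ('a \<Rightarrow> (nat \<Rightarrow>\<^sub>C real)) \<Rightarrow> real"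
  where "cost K v \<theta> = (LINT x|lebesgue_on K. (\<Sum>i. \<theta> x i * v x i))"

definition minimizers ::
    "'a::euclidean_space set \<Rightarrow> (nat \<Rightarrow> 'a \<Rightarrow> 'b::euclidean_space) \<Rightarrow> 'b \<Rightarrow> ('a \<Rightarrow> nat \<Rightarrow> real)
      \<Rightarrow> ('a \<Rightarrow> (nat \<Rightarrow>\<^sub>C real)) set"
  where "minimizers K f \<alpha> v =
           {\<theta> \<in> admissible K f \<alpha>. \<forall>\<theta>' \<in> admissible K f \<alpha>. cost K v \<theta> \<le> cost K v \<theta>'}"

definition unique_solvable ::
    "'a::euclidean_space set \<Rightarrow> (nat \<Rightarrow> 'a \<Rightarrow> 'b::euclidean_space) \<Rightarrow> 'b \<Rightarrow> ('a \<Rightarrow> nat \<Rightarrow> real) set"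
  where "unique_solvable K f \<alpha> = {v \<in> mspace (C_ell1 K).
           \<exists>\<theta> \<in> minimizers K f \<alpha> v. \<forall>\<theta>' \<in> minimizers K f \<alpha> v.
             AE x in lebesgue_on K. \<theta>' x = \<theta> x}"

end

theory Submission
  imports Defs "HOL-Probability.Distribution_Functions"
begin

text \<open>
  Call a field pure if almost every value is a vertex of the infinite simplex. Lyapunov's theorem for
  countable families (every field has the same integrals against finitely many dominated families as
  some pure field) gives the bang-bang property: the unique minimizer must agree with a pure
  competitor of equal cost. No compactness is available for existence, because mass may escape to
  \<open>i \<longlonglongrightarrow> \<infinity>\<close>. Instead, subtract from \<open>v\<close> a small multiple of a continuous approximation of a
  pure near-minimizer. This penalizes the \<open>L\<^sup>1\<close> distance to that field, so all near-minimizers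
  of the perturbed problem lie close to each other. The costs with near-minimizers concentrated up to
  \<open>2\<^sup>-\<^sup>k\<close> thus form open dense sets, and on their intersection minimizing sequences converge
  in \<open>L\<^sup>1\<close> to the unique minimizer.

  Lyapunov's theorem itself is proved by moving mass towards or away from one vertex on a few cells of
  equal measure, with signs given by a linear relation between the resulting changes of the integral.
  Each move makes a fixed fraction of the fractional set integral, and the moves converge by
  Borel--Cantelli.
\<close>

section \<open>Sequences in the infinite simplex\<close>

text \<open>The penalty must be linear in the field, since costs can only be changed by adding a
  linear functional. For a pure target this is possible: on the simplex, half the l1 distance to
  vertex \<open>k\<close> equals one minus the entry at \<open>k\<close>, an affine function. This
  is why near-minimizers have to be replaced by pure ones before the cost is perturbed.

  The escape of mass also blocks the usual proof of Lyapunov's theorem, which takes an extreme point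
  of a weakly compact set of fields. A direct construction meets the same danger: if the coordinates
  become integral one after the other, all of them may tend to 0. Therefore the mass carried by
  finitely many coordinates over the fractional set is preserved as one more integral constraint,
  which forces a fixed share of that set to reach vertices at a finite stage. Since extra
  constraints are just extra components of a vector-valued family, the cost is handled in the same
  way. All moves keep zero entries at zero, so that a vertex once reached is never left.\<close>

definition simplex_seq :: "(nat \<Rightarrow> real) set"
  where "simplex_seq = {a. (\<forall>i. 0 \<le> a i) \<and> a sums 1}"

definition vertex :: "nat \<Rightarrow> nat \<Rightarrow> real"
  where "vertex k i = (if i = k then 1 else 0)"

definition bary :: "(nat \<Rightarrow> real) \<Rightarrow> (nat \<Rightarrow> 'b::real_normed_vector) \<Rightarrow> 'b"
  where "bary a b = (\<Sum>i. a i *\<^sub>R b i)"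

lemma simplex_seq_nonneg: "a \<in> simplex_seq \<Longrightarrow> 0 \<le> a i"
  by (simp add: simplex_seq_def)

lemma simplex_seq_sum_le:
  assumes "a \<in> simplex_seq" "finite I"
  shows "sum a I \<le> 1"
  using assms by (auto simp: simplex_seq_def sums_iff intro!: sum_le_suminf[of a I, THEN order_trans])

lemma simplex_seq_le_1: "a \<in> simplex_seq \<Longrightarrow> a i \<le> 1"
  using simplex_seq_sum_le[of a "{i}"] by simp

lemma vertex_sums: "vertex k sums 1"
proof -
  have "vertex k sums (\<Sum>i\<in>{k}. vertex k i)"
    by (rule sums_finite) (auto simp: vertex_def)
  then show ?thesis by (simp add: vertex_def)
qed

lemma vertex_in_simplex_seq: "vertex k \<in> simplex_seq"
  using vertex_sums[of k] by (auto simp: simplex_seq_def vertex_def)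

lemma simplex_seq_eq_vertex:
  assumes a: "a \<in> simplex_seq" and "a k = 1"
  shows "a = vertex k"
proof
  fix i
  have "a i = 0" if "i \<noteq> k"
    using simplex_seq_sum_le[OF a, of "{i, k}"] simplex_seq_nonneg[OF a, of i] that assms(2) by simp
  then show "a i = vertex k i" using assms(2) by (auto simp: vertex_def)
qed

text \<open>A move that keeps zero entries at zero cannot leave a vertex, because the support of the
  new value stays inside one index. This protects points already treated against all later
  moves.\<close>

lemma simplex_seq_supported_eq_vertex:
  assumes a: "a \<in> simplex_seq" and "\<And>i. i \<noteq> k \<Longrightarrow> a i = 0"
  shows "a = vertex k"
proof -
  have "a sums (\<Sum>i\<in>{k}. a i)"
    by (rule sums_finite) (auto simp: assms(2))
  then have "a k = 1"
    using a by (auto simp: simplex_seq_def dest: sums_unique2)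
  then show ?thesis
    by (rule simplex_seq_eq_vertex[OF a])
qed

lemma simplex_seq_01_vertex:
  assumes a: "a \<in> simplex_seq" and "\<And>i. a i \<in> {0, 1}"
  shows "\<exists>k. a = vertex k"
proof -
  have "\<exists>k. a k \<noteq> 0"
  proof (rule ccontr)
    assume "\<not> ?thesis"
    then have "a = (\<lambda>_. 0)" by auto
    then show False using a sums_unique2[OF _ sums_zero] by (fastforce simp: simplex_seq_def)
  qed
  then show ?thesis using assms simplex_seq_eq_vertex by blast
qed

lemma simplex_seq_summable_norm:
  fixes b :: "nat \<Rightarrow> 'b::real_normed_vector"
  assumes a: "a \<in> simplex_seq" and b: "\<And>i. norm (b i) \<le> B"
  shows "summable (\<lambda>i. norm (a i *\<^sub>R b i))"
proof (rule summable_comparison_test')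
  show "summable (\<lambda>i. a i * B)"
    using a by (intro summable_mult2) (auto simp: simplex_seq_def sums_iff)
  show "norm (norm (a i *\<^sub>R b i)) \<le> a i * B" if "i \<ge> 0" for i
    using b[of i] simplex_seq_nonneg[OF a, of i] by (simp add: mult_left_mono)
qed

lemma simplex_seq_summable:
  fixes b :: "nat \<Rightarrow> 'b::banach"
  assumes "a \<in> simplex_seq" "\<And>i. norm (b i) \<le> B"
  shows "summable (\<lambda>i. a i *\<^sub>R b i)"
  by (rule summable_norm_cancel[OF simplex_seq_summable_norm[OF assms]])

lemma norm_bary_le:
  fixes b :: "nat \<Rightarrow> 'b::banach"
  assumes a: "a \<in> simplex_seq" and b: "\<And>i. norm (b i) \<le> B"
  shows "norm (bary a b) \<le> B"
proof -
  have "norm (bary a b) \<le> (\<Sum>i. norm (a i *\<^sub>R b i))"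
    unfolding bary_def by (rule summable_norm[OF simplex_seq_summable_norm[OF assms]])
  also have "\<dots> \<le> (\<Sum>i. a i * B)"
    using a b
    by (intro suminf_le simplex_seq_summable_norm[OF assms] summable_mult2)
       (auto simp: simplex_seq_def sums_iff mult_left_mono)
  also have "\<dots> = B"
    using a suminf_mult2[of a B] by (auto simp: simplex_seq_def sums_iff)
  finally show ?thesis .
qed

lemma bary_vertex: "bary (vertex k) b = b k"
proof -
  have "(\<lambda>i. vertex k i *\<^sub>R b i) sums (\<Sum>i\<in>{k}. vertex k i *\<^sub>R b i)"
    by (rule sums_finite) (auto simp: vertex_def)
  then show ?thesis by (simp add: vertex_def bary_def sums_iff)
qed

text \<open>
  The weight is the largest for which \<open>pull k 1 a\<close> and \<open>pull k (-1) a\<close> both stay inside the simplex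
  (the case \<open>a k = 1\<close> being irrelevant).
\<close>

definition pull_weight :: "nat \<Rightarrow> (nat \<Rightarrow> real) \<Rightarrow> real"
  where "pull_weight k a = (if a k = 1 then 0 else if a k \<le> 1/2 then a k / (1 - a k) else 1)"

definition pull :: "nat \<Rightarrow> real \<Rightarrow> (nat \<Rightarrow> real) \<Rightarrow> nat \<Rightarrow> real"
  where "pull k c a i = a i + c * pull_weight k a * (vertex k i - a i)"

text \<open>The second bound keeps the other entries nonnegative when mass is pulled to
  \<open>k\<close>; the third keeps entry \<open>k\<close> nonnegative when mass is pushed away from
  it.\<close>

lemma pull_weight_bounds:
  assumes a: "a \<in> simplex_seq"
  shows "0 \<le> pull_weight k a" "pull_weight k a \<le> 1" "pull_weight k a * (1 - a k) \<le> a k"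
  using simplex_seq_nonneg[OF a, of k] simplex_seq_le_1[OF a, of k]
  by (auto simp: pull_weight_def divide_simps)

lemma pull_in_simplex_seq:
  assumes a: "a \<in> simplex_seq" and c: "\<bar>c\<bar> \<le> 1"
  shows "pull k c a \<in> simplex_seq"
proof -
  let ?w = "pull_weight k a"
  note w = pull_weight_bounds[OF a, of k]
  have cw: "\<bar>c * ?w\<bar> \<le> ?w"
    using c w by (simp add: abs_mult mult_left_le_one_le)
  have "0 \<le> pull k c a i" for i
  proof (cases "i = k")
    case True
    have "\<bar>c * ?w * (1 - a k)\<bar> \<le> ?w * (1 - a k)"
      using mult_right_mono[OF cw, of "1 - a k"] simplex_seq_le_1[OF a, of k] by (simp add: abs_mult)
    then show ?thesis using w True by (simp add: pull_def vertex_def)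
  next
    case False
    have "c * ?w \<le> 1" using cw w by linarith
    then have "c * ?w * a i \<le> 1 * a i"
      using simplex_seq_nonneg[OF a, of i] by (intro mult_right_mono) auto
    then show ?thesis using False by (simp add: pull_def vertex_def)
  qed
  moreover have "pull k c a sums (1 + c * ?w * (1 - 1))"
    unfolding pull_def using a
    by (intro sums_add sums_mult sums_diff vertex_sums) (auto simp: simplex_seq_def)
  ultimately show ?thesis by (simp add: simplex_seq_def)
qed

lemma pull_fixed: "a k \<in> {0, 1} \<Longrightarrow> pull k c a = a"
  by (auto simp: pull_def pull_weight_def)

lemma pull_support: "a i = 0 \<Longrightarrow> pull k c a i = 0"
  by (auto simp: pull_def vertex_def pull_weight_def)

text \<open>With the next lemma: whatever \<open>a k\<close> is, one of the two extreme moves makes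
  it integral. From 1/2 upwards the pull ends at the vertex; up to 1/2 the opposite move empties the
  entry.\<close>

lemma pull_1: "1/2 \<le> a k \<Longrightarrow> pull k 1 a k = 1"
  by (auto simp: pull_def pull_weight_def vertex_def divide_simps)

lemma pull_minus_1: "a k \<le> 1/2 \<Longrightarrow> pull k (-1) a k = 0"
  by (auto simp: pull_def pull_weight_def vertex_def divide_simps)

text \<open>The change is linear in \<open>c\<close>. With constant strengths on disjoint cells, the
  integral therefore changes by a linear combination of fixed vectors, and cancelling this change is
  linear algebra.\<close>

lemma bary_pull:
  fixes b :: "nat \<Rightarrow> 'b::banach"
  assumes a: "a \<in> simplex_seq" and b: "\<And>i. norm (b i) \<le> B"
  shows "bary (pull k c a) b = bary a b + (c * pull_weight k a) *\<^sub>R (b k - bary a b)"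
proof -
  let ?w = "pull_weight k a"
  have s: "(\<lambda>i. a i *\<^sub>R b i) sums bary a b"
    unfolding bary_def by (rule summable_sums[OF simplex_seq_summable[OF a b]])
  have v: "(\<lambda>i. vertex k i *\<^sub>R b i) sums b k"
    using summable_sums[OF simplex_seq_summable[where b = b, OF vertex_in_simplex_seq b], of k]
      bary_vertex[of k b]
    by (simp add: bary_def)
  have "(\<lambda>i. a i *\<^sub>R b i + (c * ?w) *\<^sub>R (vertex k i *\<^sub>R b i - a i *\<^sub>R b i)) sums
      (bary a b + (c * ?w) *\<^sub>R (b k - bary a b))"
    by (intro sums_add s sums_scaleR_right sums_diff v)
  then show ?thesis
    unfolding bary_def pull_def by (simp add: sums_iff algebra_simps)
qed

section \<open>Measurable fields of probability sequences\<close>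

definition simplex_fields :: "'a measure \<Rightarrow> ('a \<Rightarrow> nat \<Rightarrow> real) set"
  where "simplex_fields M = {t. (\<forall>i. (\<lambda>x. t x i) \<in> borel_measurable M) \<and>
           (\<forall>x\<in>space M. t x \<in> simplex_seq)}"

text \<open>The majorant bounds all \<open>g i\<close> at every point, so that each barycentre
  converges absolutely everywhere and one function dominates the integrands along any sequence of
  fields.\<close>

definition dominated :: "'a measure \<Rightarrow> (nat \<Rightarrow> 'a \<Rightarrow> 'b::{real_normed_vector}) \<Rightarrow> bool"
  where "dominated M g \<longleftrightarrow> (\<forall>i. g i \<in> borel_measurable M) \<and>
           (\<exists>G::'a \<Rightarrow> real. integrable M G \<and> (\<forall>x\<in>space M. \<forall>i. norm (g i x) \<le> G x))"

lemma simplex_fieldsD: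
  assumes "t \<in> simplex_fields M"
  shows "(\<lambda>x. t x i) \<in> borel_measurable M" "x \<in> space M \<Longrightarrow> t x \<in> simplex_seq"
  using assms by (auto simp: simplex_fields_def)

lemma integrable_bary:
  fixes g :: "nat \<Rightarrow> 'a \<Rightarrow> 'b::{banach, second_countable_topology}"
  assumes t: "t \<in> simplex_fields M" and g: "dominated M g"
  shows "integrable M (\<lambda>x. bary (t x) (\<lambda>i. g i x))"
proof -
  obtain G :: "'a \<Rightarrow> real" where G: "integrable M G" "\<And>x i. x \<in> space M \<Longrightarrow> norm (g i x) \<le> G x"
    using g by (auto simp: dominated_def)
  have [measurable]: "g i \<in> borel_measurable M" "(\<lambda>x. t x i) \<in> borel_measurable M" for i
    using g t by (auto simp: dominated_def simplex_fields_def)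
  show ?thesis
  proof (rule Bochner_Integration.integrable_bound[OF G(1)])
    show "(\<lambda>x. bary (t x) (\<lambda>i. g i x)) \<in> borel_measurable M"
      unfolding bary_def by measurable
    have "norm (bary (t x) (\<lambda>i. g i x)) \<le> norm (G x)" if "x \<in> space M" for x
      using norm_bary_le[of "t x" "\<lambda>i. g i x" "G x"] G(2)[OF that] simplex_fieldsD(2)[OF t that]
      by (simp add: order_trans[OF _ abs_ge_self])
    then show "AE x in M. norm (bary (t x) (\<lambda>i. g i x)) \<le> norm (G x)" by simp
  qed
qed

text \<open>
  Each step modifies the field only where \<open>P\<close> still holds, so by Borel--Cantelli the iterates are
  eventually constant almost everywhere.
\<close>

lemma (in finite_measure) iterate_shrinking:
  fixes g :: "nat \<Rightarrow> 'a \<Rightarrow> 'b::{banach, second_countable_topology}"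
  assumes g: "dominated M g" and \<rho>: "0 \<le> \<rho>" "\<rho> < 1"
    and meas: "\<And>t. t \<in> simplex_fields M \<Longrightarrow> {x \<in> space M. P (t x)} \<in> sets M"
    and step: "\<And>t. t \<in> simplex_fields M \<Longrightarrow> \<exists>t'\<in>simplex_fields M.
        (LINT x|M. bary (t' x) (\<lambda>i. g i x)) = (LINT x|M. bary (t x) (\<lambda>i. g i x)) \<and>
        (\<forall>x\<in>space M. \<not> P (t x) \<longrightarrow> t' x = t x) \<and>
        (\<forall>x\<in>space M. \<forall>i. t x i = 0 \<longrightarrow> t' x i = 0) \<and>
        measure M {x \<in> space M. P (t' x)} \<le> \<rho> * measure M {x \<in> space M. P (t x)}"
    and t: "t \<in> simplex_fields M"
  shows "\<exists>t'\<in>simplex_fields M.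
        (LINT x|M. bary (t' x) (\<lambda>i. g i x)) = (LINT x|M. bary (t x) (\<lambda>i. g i x)) \<and>
        (\<forall>x\<in>space M. \<forall>i. t x i = 0 \<longrightarrow> t' x i = 0) \<and> (AE x in M. \<not> P (t' x))"
proof -
  define R where "R u u' \<longleftrightarrow>
        (LINT x|M. bary (u' x) (\<lambda>i. g i x)) = (LINT x|M. bary (u x) (\<lambda>i. g i x)) \<and>
        (\<forall>x\<in>space M. \<not> P (u x) \<longrightarrow> u' x = u x) \<and>
        (\<forall>x\<in>space M. \<forall>i. u x i = 0 \<longrightarrow> u' x i = 0) \<and>
        measure M {x \<in> space M. P (u' x)} \<le> \<rho> * measure M {x \<in> space M. P (u x)}" for u u'
  have "\<exists>s. s 0 = t \<and> (\<forall>n. s n \<in> simplex_fields M \<and> R (s n) (s (Suc n)))"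
  proof -
    have "\<exists>s. \<forall>n. (s n \<in> simplex_fields M \<and> (n = 0 \<longrightarrow> s n = t)) \<and> R (s n) (s (Suc n))"
    proof (rule dependent_nat_choice)
      show "\<exists>u. u \<in> simplex_fields M \<and> (0 = (0::nat) \<longrightarrow> u = t)" using t by blast
      show "\<exists>u'. (u' \<in> simplex_fields M \<and> (Suc n = 0 \<longrightarrow> u' = t)) \<and> R u u'"
        if "u \<in> simplex_fields M \<and> (n = 0 \<longrightarrow> u = t)" for u n
        using step[of u] that by (auto simp: R_def)
    qed
    then show ?thesis by blast
  qed
  then obtain s where s0: "s 0 = t" and s: "\<And>n. s n \<in> simplex_fields M" and R: "\<And>n. R (s n) (s (Suc n))"
    by blast
  let ?F = "\<lambda>n. {x \<in> space M. P (s n x)}"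
  have F[measurable]: "?F n \<in> sets M" for n by (rule meas[OF s])
  have small: "measure M (?F n) \<le> measure M (space M) * \<rho> ^ n" for n
  proof (induction n)
    case 0 show ?case by (simp add: bounded_measure)
  next
    case (Suc n)
    have "measure M (?F (Suc n)) \<le> \<rho> * measure M (?F n)" using R[of n] by (simp add: R_def)
    also have "\<dots> \<le> \<rho> * (measure M (space M) * \<rho> ^ n)" using Suc \<rho> by (intro mult_left_mono)
    finally show ?case by (simp add: mult_ac)
  qed
  have "summable (\<lambda>n. measure M (?F n))"
    by (rule summable_comparison_test'[of "\<lambda>n. measure M (space M) * \<rho> ^ n"])
       (use \<rho> small in \<open>auto intro: summable_mult summable_geometric\<close>)
  then have AE1: "AE x in M. eventually (\<lambda>n. x \<in> space M - ?F n) sequentially"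
    by (intro borel_cantelli_AE1) (auto simp: less_top[symmetric])
  have const: "s m x = s n x" if "x \<in> space M" "\<not> P (s n x)" "n \<le> m" for x n m
    using that(3)
  proof (induction m rule: dec_induct)
    case (step m)
    then show ?case using R[of m] that by (auto simp: R_def)
  qed simp
  \<comment> \<open>The eventual value of the iterates. The default \<open>t x\<close> on points
    that never leave \<open>P\<close> keeps the value in the simplex and the zero entries at
    zero.\<close>
  define T where "T x = (if \<exists>n. \<not> P (s n x) then s (LEAST n. \<not> P (s n x)) x else t x)" for x
  have T_eq: "T x = s n x" if "x \<in> space M" "\<not> P (s n x)" for x n
    using const[OF that(1) LeastI[of "\<lambda>n. \<not> P (s n x)", OF that(2)] Least_le[of "\<lambda>n. \<not> P (s n x)", OF that(2)]] that
    by (auto simp: T_def)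
  \<comment> \<open>Where \<open>P\<close> never fails, \<open>s m x\<close> need not converge, so
    it is replaced by \<open>t x\<close>. Each \<open>u m\<close> depends on finitely many
    measurable conditions and converges to \<open>T\<close> at every point, which makes
    \<open>T\<close> measurable.\<close>
  define u where "u m x = (if \<exists>n\<le>m. \<not> P (s n x) then s m x else t x)" for m x
  have T_lim: "(\<lambda>m. u m x i) \<longlonglongrightarrow> T x i" if x: "x \<in> space M" for x i
  proof (cases "\<exists>n. \<not> P (s n x)")
    case True
    then obtain n where n: "\<not> P (s n x)" by blast
    have "u m x i = T x i" if "m \<ge> n" for m
      using const[OF x n that] T_eq[OF x n] n that by (auto simp: u_def)
    then show ?thesis by (intro tendsto_eventually) (auto simp: eventually_sequentially)
  next
    case False
    then show ?thesis by (simp add: u_def T_def)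
  qed
  have [measurable]: "(\<lambda>x. s m x i) \<in> borel_measurable M" "(\<lambda>x. t x i) \<in> borel_measurable M" for m i
    using s t by (auto simp: simplex_fields_def)
  have "(\<lambda>x. u m x i) \<in> borel_measurable M" for m i
  proof -
    have [measurable]: "Measurable.pred M (\<lambda>x. P (s n x))" for n
      using F[of n] by (simp add: pred_def)
    have "(\<lambda>x. if \<exists>n\<in>{..m}. \<not> P (s n x) then s m x i else t x i) \<in> borel_measurable M"
      by measurable
    then show ?thesis by (simp add: u_def if_distrib if_distribR cong: if_cong)
  qed
  then have "(\<lambda>x. T x i) \<in> borel_measurable M" for i
    by (rule borel_measurable_LIMSEQ_real[rotated]) (rule T_lim)
  moreover have "T x \<in> simplex_seq" if "x \<in> space M" for x
    using simplex_fieldsD(2)[OF s that] simplex_fieldsD(2)[OF t that] by (simp add: T_def)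
  ultimately have T: "T \<in> simplex_fields M" by (simp add: simplex_fields_def)
  have supp: "s n x i = 0" if "x \<in> space M" "t x i = 0" for n x i
    by (induction n) (use s0 that R in \<open>auto simp: R_def\<close>)
  have ev: "AE x in M. eventually (\<lambda>n. s n x = T x \<and> \<not> P (s n x)) sequentially"
    using AE1
  proof eventually_elim
    case (elim x)
    then show ?case by eventually_elim (use T_eq in auto)
  qed
  obtain G :: "'a \<Rightarrow> real" where G: "integrable M G" "\<And>x i. x \<in> space M \<Longrightarrow> norm (g i x) \<le> G x"
    using g by (auto simp: dominated_def)
  have "(\<lambda>n. LINT x|M. bary (s n x) (\<lambda>i. g i x)) \<longlonglongrightarrow> (LINT x|M. bary (T x) (\<lambda>i. g i x))"
  proof (rule integral_dominated_convergence[OF _ _ G(1)])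
    show "AE x in M. (\<lambda>n. bary (s n x) (\<lambda>i. g i x)) \<longlonglongrightarrow> bary (T x) (\<lambda>i. g i x)"
      using ev by eventually_elim (auto intro!: tendsto_eventually elim: eventually_mono)
    show "AE x in M. norm (bary (s n x) (\<lambda>i. g i x)) \<le> G x" for n
      using norm_bary_le[OF simplex_fieldsD(2)[OF s] G(2)] by auto
  qed (intro borel_measurable_integrable integrable_bary T s g)+
  moreover have "(LINT x|M. bary (s n x) (\<lambda>i. g i x)) = (LINT x|M. bary (t x) (\<lambda>i. g i x))" for n
    by (induction n) (use s0 R in \<open>auto simp: R_def\<close>)
  ultimately have "(LINT x|M. bary (T x) (\<lambda>i. g i x)) = (LINT x|M. bary (t x) (\<lambda>i. g i x))"
    by (simp add: LIMSEQ_const_iff)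
  moreover have "T x i = 0" if "x \<in> space M" "t x i = 0" for x i
    using supp[OF that] that by (simp add: T_def)
  moreover have "AE x in M. \<not> P (T x)"
    using ev
  proof eventually_elim
    case (elim x)
    then have "\<exists>n. s n x = T x \<and> \<not> P (s n x)"
      by (rule eventually_happens'[OF sequentially_bot])
    then show ?case by metis
  qed
  ultimately show ?thesis using T by blast
qed

section \<open>Lyapunov's theorem for countable families\<close>

text \<open>This is the intermediate value property that Sierpinski's theorem derives from the
  absence of atoms. It is the form in which cells of prescribed measure are cut out.\<close>

definition nonatomic :: "'a measure \<Rightarrow> bool"
  where "nonatomic M \<longleftrightarrow> (\<forall>A\<in>sets M. \<forall>r. 0 \<le> r \<and> r \<le> measure M A \<longrightarrow>
           (\<exists>B\<in>sets M. B \<subseteq> A \<and> measure M B = r))"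

lemma (in finite_measure) nonatomic_cells:
  assumes na: "nonatomic M" and F: "F \<in> sets M" and "0 \<le> r" "real m * r \<le> measure M F"
  shows "\<exists>A::nat \<Rightarrow> 'a set. (\<forall>j<m. A j \<in> sets M \<and> A j \<subseteq> F \<and> measure M (A j) = r) \<and>
           disjoint_family_on A {..<m}"
  using assms(4)
proof (induction m)
  case 0 show ?case by (simp add: disjoint_family_on_def)
next
  case (Suc m)
  have "real m * r \<le> measure M F"
    using Suc.prems \<open>0 \<le> r\<close> by (simp add: algebra_simps)
  then obtain A where A: "\<And>j. j < m \<Longrightarrow> A j \<in> sets M \<and> A j \<subseteq> F \<and> measure M (A j) = r"
    and disj: "disjoint_family_on A {..<m}"
    using Suc.IH by blast
  define U where "U = (\<Union>j<m. A j)"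
  have U: "U \<in> sets M" "U \<subseteq> F" using A by (auto simp: U_def)
  have "measure M U = (\<Sum>j<m. measure M (A j))"
    unfolding U_def using A disj by (intro finite_measure_finite_Union) auto
  then have "measure M U = real m * r" using A by simp
  then have "r \<le> measure M (F - U)"
    using Suc.prems finite_measure_Diff[OF F U] by (simp add: algebra_simps)
  then obtain B where B: "B \<in> sets M" "B \<subseteq> F - U" "measure M B = r"
    using na F U \<open>0 \<le> r\<close> unfolding nonatomic_def by (meson sets.Diff)
  define A' where "A' j = (if j = m then B else A j)" for j
  have "A' j \<in> sets M \<and> A' j \<subseteq> F \<and> measure M (A' j) = r" if "j < Suc m" for j
    using that A[of j] B by (auto simp: A'_def less_Suc_eq)
  moreover have "disjoint_family_on A' {..<Suc m}"
    using disj B(2) by (auto simp: disjoint_family_on_def A'_def U_def less_Suc_eq) blast+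
  ultimately show ?case by blast
qed

text \<open>Division by the coefficient of largest modulus makes all coefficients admissible
  strengths for \<open>pull\<close>, and makes one cell move with full strength.\<close>

lemma exists_normalised_linear_relation:
  fixes q :: "nat \<Rightarrow> 'b::euclidean_space"
  assumes "m > DIM('b)"
  shows "\<exists>c. (\<forall>j<m. \<bar>c j\<bar> \<le> 1) \<and> (\<exists>l<m. c l = 1) \<and> (\<Sum>j<m. c j *\<^sub>R q j) = 0"
proof -
  have "\<exists>d. (\<exists>j<m. d j \<noteq> 0) \<and> (\<Sum>j<m. d j *\<^sub>R q j) = 0"
  \<comment> \<open>\<open>dependent\<close> speaks about sets and does not see repetitions; two
    equal vectors give a relation with coefficients 1 and -1.\<close>
  proof (cases "inj_on q {..<m}")
    case True
    then have "card (q ` {..<m}) > DIM('b)" using assms by (simp add: card_image)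
    then have "dependent (q ` {..<m})" by (intro dependent_biggerset) auto
    then obtain u v where "v \<in> q ` {..<m}" "u v \<noteq> 0" "(\<Sum>v\<in>q ` {..<m}. u v *\<^sub>R v) = 0"
      by (subst (asm) dependent_finite) auto
    then show ?thesis
      by (intro exI[of _ "\<lambda>j. u (q j)"]) (auto simp: sum.reindex[OF True])
  next
    case False
    then obtain a b where ab: "a < m" "b < m" "a \<noteq> b" "q a = q b" by (auto simp: inj_on_def)
    let ?d = "\<lambda>j. if j = a then 1 else if j = b then -1 else (0::real)"
    have "(\<Sum>j<m. ?d j *\<^sub>R q j) = (\<Sum>j\<in>{a, b}. ?d j *\<^sub>R q j)"
      using ab by (intro sum.mono_neutral_right) auto
    then have "(\<Sum>j<m. ?d j *\<^sub>R q j) = 0" using ab by simp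
    then show ?thesis using ab by (intro exI[of _ ?d]) auto
  qed
  then obtain d i where d: "i < m" "d i \<noteq> 0" "(\<Sum>j<m. d j *\<^sub>R q j) = 0" by blast
  have "\<exists>l<m. \<forall>j<m. \<bar>d j\<bar> \<le> \<bar>d l\<bar>"
  proof -
    have "Max ((\<lambda>j. \<bar>d j\<bar>) ` {..<m}) \<in> (\<lambda>j. \<bar>d j\<bar>) ` {..<m}" using d by (intro Max_in) auto
    then obtain l where "l < m" "Max ((\<lambda>j. \<bar>d j\<bar>) ` {..<m}) = \<bar>d l\<bar>" by auto
    moreover have "\<bar>d j\<bar> \<le> Max ((\<lambda>j. \<bar>d j\<bar>) ` {..<m})" if "j < m" for j
      using that by (intro Max_ge) auto
    ultimately show ?thesis by auto
  qed
  then obtain l where l: "l < m" "\<And>j. j < m \<Longrightarrow> \<bar>d j\<bar> \<le> \<bar>d l\<bar>" by blast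
  then have "d l \<noteq> 0" using d by force
  have "(\<Sum>j<m. (d j / d l) *\<^sub>R q j) = (1 / d l) *\<^sub>R (\<Sum>j<m. d j *\<^sub>R q j)"
    by (simp add: scaleR_sum_right)
  then show ?thesis
    using l \<open>d l \<noteq> 0\<close> d by (intro exI[of _ "\<lambda>j. d j / d l"]) (auto simp: abs_divide divide_le_eq_1)
qed

section \<open>Moves that make coordinates integral and preserve the integral\<close>

lemma borel_measurable_pull_weight [measurable (raw)]:
  assumes [measurable]: "(\<lambda>x. t x k) \<in> borel_measurable M"
  shows "(\<lambda>x. pull_weight k (t x)) \<in> borel_measurable M"
  unfolding pull_weight_def by measurable

text \<open>One cell more than the dimension makes the changes \<open>q j\<close> dependent, and
  moving the cells according to the relation leaves the integral fixed. The cell moved with full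
  strength becomes integral at \<open>k\<close> on at least half of its measure, which is the share
  \<open>1 / (2 * real m)\<close> of the fractional set. The double negation is the negated
  \<open>P\<close> of \<open>iterate_shrinking\<close>.\<close>

lemma (in finite_measure) integral_coordinate_step:
  fixes g :: "nat \<Rightarrow> 'a \<Rightarrow> 'b::euclidean_space"
  assumes na: "nonatomic M" and g: "dominated M g" and t: "t \<in> simplex_fields M"
  shows "\<exists>t'\<in>simplex_fields M.
        (LINT x|M. bary (t' x) (\<lambda>i. g i x)) = (LINT x|M. bary (t x) (\<lambda>i. g i x)) \<and>
        (\<forall>x\<in>space M. \<not> t x k \<notin> {0, 1} \<longrightarrow> t' x = t x) \<and>
        (\<forall>x\<in>space M. \<forall>i. t x i = 0 \<longrightarrow> t' x i = 0) \<and>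
        measure M {x \<in> space M. t' x k \<notin> {0, 1}}
          \<le> (1 - 1 / (2 * real (Suc DIM('b)))) * measure M {x \<in> space M. t x k \<notin> {0, 1}}"
proof -
  define m where "m = Suc DIM('b)"
  define F where "F = {x \<in> space M. t x k \<notin> {0, 1}}"
  have [measurable]: "(\<lambda>x. t x i) \<in> borel_measurable M" "g i \<in> borel_measurable M" for i
    using t g by (auto simp: simplex_fields_def dominated_def)
  have F[measurable]: "F \<in> sets M" unfolding F_def by measurable
  define r where "r = measure M F / real m"
  have "\<exists>A::nat \<Rightarrow> 'a set. (\<forall>j<m. A j \<in> sets M \<and> A j \<subseteq> F \<and> measure M (A j) = r) \<and>
           disjoint_family_on A {..<m}"
    by (rule nonatomic_cells[OF na F]) (auto simp: r_def m_def)
  then obtain A where A: "\<And>j. j < m \<Longrightarrow> A j \<in> sets M \<and> A j \<subseteq> F \<and> measure M (A j) = r"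
    and disj: "disjoint_family_on A {..<m}" by blast
  define h where "h x = pull_weight k (t x) *\<^sub>R (g k x - bary (t x) (\<lambda>i. g i x))" for x
  obtain G :: "'a \<Rightarrow> real" where G: "integrable M G" "\<And>x i. x \<in> space M \<Longrightarrow> norm (g i x) \<le> G x"
    using g by (auto simp: dominated_def)
  have int_bary: "integrable M (\<lambda>x. bary (t x) (\<lambda>i. g i x))" by (rule integrable_bary[OF t g])
  have int_g: "integrable M (g k)"
    by (rule Bochner_Integration.integrable_bound[OF G(1)])
       (use G(2) in \<open>auto intro!: AE_I2 order_trans[OF _ abs_ge_self]\<close>)
  have int_h: "integrable M h"
  proof (rule Bochner_Integration.integrable_bound)
    show "integrable M (\<lambda>x. g k x - bary (t x) (\<lambda>i. g i x))" using int_g int_bary by simp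
    have [measurable]: "(\<lambda>x. bary (t x) (\<lambda>i. g i x)) \<in> borel_measurable M"
      using int_bary by simp
    show "h \<in> borel_measurable M" unfolding h_def by measurable
    show "AE x in M. norm (h x) \<le> norm (g k x - bary (t x) (\<lambda>i. g i x))"
      using pull_weight_bounds[OF simplex_fieldsD(2)[OF t]]
      by (intro AE_I2) (auto simp: h_def intro!: mult_left_le_one_le)
  qed
  define q where "q j = (LINT x|M. indicator (A j) x *\<^sub>R h x)" for j
  obtain c0 l where c0: "\<And>j. j < m \<Longrightarrow> \<bar>c0 j\<bar> \<le> 1" "l < m" "c0 l = 1" "(\<Sum>j<m. c0 j *\<^sub>R q j) = 0"
    using exists_normalised_linear_relation[of m q] by (auto simp: m_def)
  \<comment> \<open>the sign of the relation is chosen such that at least half of the cell \<open>l\<close> reaches \<open>0\<close> or \<open>1\<close>\<close>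
  define H where "H = {x \<in> A l. 1/2 \<le> t x k}"
  define L where "L = {x \<in> A l. t x k \<le> 1/2}"
  have Al[measurable]: "A l \<in> sets M" using A c0 by blast
  have sub: "A l \<subseteq> space M" using Al sets.sets_into_space by blast
  have "H = A l \<inter> {x \<in> space M. 1/2 \<le> t x k}" "L = A l \<inter> {x \<in> space M. t x k \<le> 1/2}"
    using sub by (auto simp: H_def L_def)
  then have HL[measurable]: "H \<in> sets M" "L \<in> sets M" by auto
  have "A l = H \<union> L" by (auto simp: H_def L_def)
  then have "r \<le> measure M H + measure M L"
    using A[of l] c0(2) measure_Un_le[OF HL] by simp
  then obtain \<sigma> :: real and Z where \<sigma>: "\<sigma> = 1 \<and> Z = H \<or> \<sigma> = -1 \<and> Z = L" and Z: "r / 2 \<le> measure M Z"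
    by (cases "r / 2 \<le> measure M H") (force)+
  have Z_sets[measurable]: "Z \<in> sets M" and ZA: "Z \<subseteq> A l" using \<sigma> by (auto simp: H_def L_def)
  define c where "c j = \<sigma> * c0 j" for j
  have c: "\<bar>c j\<bar> \<le> 1" if "j < m" for j using c0(1)[OF that] \<sigma> by (auto simp: c_def)
  have cq: "(\<Sum>j<m. c j *\<^sub>R q j) = 0"
    using c0(4) by (auto simp: c_def scaleR_sum_right[symmetric] simp flip: scaleR_scaleR)
  define C where "C x = (\<Sum>j<m. c j * indicator (A j) x)" for x
  have C_eq: "C x = c j" if "x \<in> A j" "j < m" for x j
  proof -
    have "C x = (\<Sum>i\<in>{j}. c i * indicator (A i) x)"
      unfolding C_def using disj that
      by (intro sum.mono_neutral_right) (auto simp: disjoint_family_on_def indicator_def)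
    then show ?thesis using that by simp
  qed
  have C_0: "C x = 0" if "\<And>j. j < m \<Longrightarrow> x \<notin> A j" for x
    using that by (auto simp: C_def intro!: sum.neutral)
  have C_abs: "\<bar>C x\<bar> \<le> 1" for x
    by (cases "\<exists>j<m. x \<in> A j") (use C_eq C_0 c in force)+
  have [measurable]: "C \<in> borel_measurable M"
    unfolding C_def using A by (intro borel_measurable_sum borel_measurable_times borel_measurable_indicator) auto
  define t' where "t' x = pull k (C x) (t x)" for x
  have t': "t' \<in> simplex_fields M"
    using pull_in_simplex_seq[OF simplex_fieldsD(2)[OF t] C_abs]
    unfolding simplex_fields_def t'_def by (auto simp: pull_def)
  have "bary (t' x) (\<lambda>i. g i x) = bary (t x) (\<lambda>i. g i x) + (\<Sum>j<m. c j *\<^sub>R (indicator (A j) x *\<^sub>R h x))"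
    if "x \<in> space M" for x
  proof -
    have "(\<Sum>j<m. c j *\<^sub>R (indicator (A j) x *\<^sub>R h x)) = C x *\<^sub>R h x"
      unfolding C_def by (simp only: scaleR_sum_left scaleR_scaleR)
    then show ?thesis
      using bary_pull[OF simplex_fieldsD(2)[OF t that], of "\<lambda>i. g i x" "G x" k "C x"] G(2)[OF that]
      by (simp add: t'_def h_def)
  qed
  then have "(LINT x|M. bary (t' x) (\<lambda>i. g i x)) =
      (LINT x|M. bary (t x) (\<lambda>i. g i x) + (\<Sum>j<m. c j *\<^sub>R (indicator (A j) x *\<^sub>R h x)))"
    by (intro Bochner_Integration.integral_cong) auto
  also have "\<dots> = (LINT x|M. bary (t x) (\<lambda>i. g i x)) + (\<Sum>j<m. c j *\<^sub>R q j)"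
  proof -
    have *: "integrable M (\<lambda>x. c j *\<^sub>R (indicator (A j) x *\<^sub>R h x))" if "j \<in> {..<m}" for j
      using integrable_mult_indicator[OF _ int_h] A that by (intro integrable_scaleR_right) auto
    have "(LINT x|M. bary (t x) (\<lambda>i. g i x) + (\<Sum>j<m. c j *\<^sub>R (indicator (A j) x *\<^sub>R h x))) =
        (LINT x|M. bary (t x) (\<lambda>i. g i x)) + (\<Sum>j<m. LINT x|M. c j *\<^sub>R (indicator (A j) x *\<^sub>R h x))"
      using * by (simp only: Bochner_Integration.integral_add[OF int_bary Bochner_Integration.integrable_sum[OF *]]
        Bochner_Integration.integral_sum)
    then show ?thesis by (simp only: q_def integral_scaleR_right)
  qed
  finally have eq: "(LINT x|M. bary (t' x) (\<lambda>i. g i x)) = (LINT x|M. bary (t x) (\<lambda>i. g i x))"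
    by (simp add: cq)
  have "{x \<in> space M. t' x k \<notin> {0, 1}} \<subseteq> F - Z"
  proof
    fix x assume x: "x \<in> {x \<in> space M. t' x k \<notin> {0, 1}}"
    then have "x \<in> F" using pull_fixed[of "t x" k "C x"] by (auto simp: F_def t'_def)
    moreover have "x \<notin> Z"
    proof
      assume "x \<in> Z"
      then have "C x = \<sigma>" using C_eq[of x l] ZA c0 by (auto simp: c_def)
      then have "t' x k \<in> {0, 1}"
        using \<sigma> \<open>x \<in> Z\<close> pull_1[of "t x" k] pull_minus_1[of "t x" k] by (auto simp: t'_def H_def L_def)
      then show False using x by simp
    qed
    ultimately show "x \<in> F - Z" by blast
  qed
  then have "measure M {x \<in> space M. t' x k \<notin> {0, 1}} \<le> measure M (F - Z)"
    by (intro finite_measure_mono) auto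
  also have "\<dots> = measure M F - measure M Z"
    using ZA A c0(2) by (intro finite_measure_Diff) auto
  also have "\<dots> \<le> (1 - 1 / (2 * real m)) * measure M F"
    using Z by (simp add: r_def algebra_simps)
  finally have "measure M {x \<in> space M. t' x k \<notin> {0, 1}} \<le> (1 - 1 / (2 * real m)) * measure M F" .
  moreover have "\<forall>x\<in>space M. \<not> t x k \<notin> {0, 1} \<longrightarrow> t' x = t x"
    by (auto simp: t'_def pull_fixed)
  moreover have "\<forall>x\<in>space M. \<forall>i. t x i = 0 \<longrightarrow> t' x i = 0"
    by (auto simp: t'_def pull_support)
  ultimately show ?thesis
    using t' eq unfolding F_def m_def by blast
qed

lemma (in finite_measure) integral_coordinate:
  fixes g :: "nat \<Rightarrow> 'a \<Rightarrow> 'b::euclidean_space"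
  assumes na: "nonatomic M" and g: "dominated M g" and t: "t \<in> simplex_fields M"
  shows "\<exists>t'\<in>simplex_fields M.
        (LINT x|M. bary (t' x) (\<lambda>i. g i x)) = (LINT x|M. bary (t x) (\<lambda>i. g i x)) \<and>
        (\<forall>x\<in>space M. \<forall>i. t x i = 0 \<longrightarrow> t' x i = 0) \<and> (AE x in M. \<not> t' x k \<notin> {0, 1})"
proof (rule iterate_shrinking[where P = "\<lambda>a. a k \<notin> {0, 1}", OF g _ _ _ _ t])
  show "0 \<le> 1 - 1 / (2 * real (Suc DIM('b)))" by (simp add: field_simps)
  show "1 - 1 / (2 * real (Suc DIM('b))) < 1" by (simp add: field_simps)
  show "{x \<in> space M. t x k \<notin> {0, 1}} \<in> sets M" if "t \<in> simplex_fields M" for t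
  proof -
    have [measurable]: "(\<lambda>x. t x k) \<in> borel_measurable M" using that by (simp add: simplex_fields_def)
    show ?thesis by measurable
  qed
qed (rule integral_coordinate_step[OF na g])

text \<open>Treating coordinate \<open>N\<close> does not spoil the earlier ones: an entry 0 stays
  0, and an entry 1 means that the value is a vertex, which the preservation of zeros keeps
  fixed.\<close>

lemma (in finite_measure) integral_initial_coordinates:
  fixes g :: "nat \<Rightarrow> 'a \<Rightarrow> 'b::euclidean_space"
  assumes na: "nonatomic M" and g: "dominated M g" and t: "t \<in> simplex_fields M"
  shows "\<exists>t'\<in>simplex_fields M.
        (LINT x|M. bary (t' x) (\<lambda>i. g i x)) = (LINT x|M. bary (t x) (\<lambda>i. g i x)) \<and>
        (\<forall>x\<in>space M. \<forall>i. t x i = 0 \<longrightarrow> t' x i = 0) \<and> (AE x in M. \<forall>k<N. t' x k \<in> {0, 1})"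
proof (induction N)
  case 0
  show ?case using t by (intro bexI[of _ t]) auto
next
  case (Suc N)
  then obtain u where u: "u \<in> simplex_fields M"
    "(LINT x|M. bary (u x) (\<lambda>i. g i x)) = (LINT x|M. bary (t x) (\<lambda>i. g i x))"
    "\<forall>x\<in>space M. \<forall>i. t x i = 0 \<longrightarrow> u x i = 0" "AE x in M. \<forall>k<N. u x k \<in> {0, 1}"
    by blast
  obtain t' where t': "t' \<in> simplex_fields M"
    "(LINT x|M. bary (t' x) (\<lambda>i. g i x)) = (LINT x|M. bary (u x) (\<lambda>i. g i x))"
    "\<forall>x\<in>space M. \<forall>i. u x i = 0 \<longrightarrow> t' x i = 0" "AE x in M. \<not> t' x N \<notin> {0, 1}"
    using integral_coordinate[OF na g u(1), of N] by blast
  have "AE x in M. \<forall>k<Suc N. t' x k \<in> {0, 1}"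
    using u(4) t'(4) AE_space
  proof eventually_elim
    case (elim x)
    have "t' x k \<in> {0, 1}" if "k < N" for k
    proof (cases "u x k = 0")
      case True then show ?thesis using t'(3) elim by auto
    next
      case False
      then have "u x = vertex k"
        using elim that simplex_seq_eq_vertex[OF simplex_fieldsD(2)[OF u(1)], of x k] by auto
      then have "t' x = vertex k"
        using simplex_seq_supported_eq_vertex[OF simplex_fieldsD(2)[OF t'(1)], of x k] t'(3) elim
        by (auto simp: vertex_def)
      then show ?thesis by (simp add: vertex_def)
    qed
    then show ?case using elim by (auto simp: less_Suc_eq)
  qed
  then show ?case using t' u by (intro bexI[of _ t']) auto
qed

text \<open>Pairing turns an additional integral constraint into further components of the family.
  It is used for the mass of the initial coordinates in \<open>vertex_step\<close> and for the cost
  in \<open>exists_pure_same_value\<close>.\<close>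

lemma dominated_Pair:
  fixes g :: "nat \<Rightarrow> 'a \<Rightarrow> 'b::euclidean_space" and e :: "nat \<Rightarrow> 'a \<Rightarrow> 'c::euclidean_space"
  assumes g: "dominated M g" and e: "dominated M e"
  shows "dominated M (\<lambda>i x. (g i x, e i x))"
proof -
  obtain G H :: "'a \<Rightarrow> real" where G: "integrable M G" "\<And>x i. x \<in> space M \<Longrightarrow> norm (g i x) \<le> G x"
    and H: "integrable M H" "\<And>x i. x \<in> space M \<Longrightarrow> norm (e i x) \<le> H x"
    using g e by (auto simp: dominated_def)
  show ?thesis
    unfolding dominated_def
  proof (intro conjI allI exI[of _ "\<lambda>x. G x + H x"] ballI)
    show "(\<lambda>x. (g i x, e i x)) \<in> borel_measurable M" for i
      using g e unfolding dominated_def by (intro borel_measurable_Pair) auto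
    show "norm (g i x, e i x) \<le> G x + H x" if "x \<in> space M" for x i
      using G(2)[OF that, of i] H(2)[OF that, of i] norm_Pair_le[of "g i x" "e i x"] by simp
  qed (use G(1) H(1) in auto)
qed

lemma integral_bary_Pair:
  fixes g :: "nat \<Rightarrow> 'a \<Rightarrow> 'b::euclidean_space" and e :: "nat \<Rightarrow> 'a \<Rightarrow> 'c::euclidean_space"
  assumes u: "u \<in> simplex_fields M" and g: "dominated M g" and e: "dominated M e"
  shows "(LINT x|M. bary (u x) (\<lambda>i. (g i x, e i x))) =
    ((LINT x|M. bary (u x) (\<lambda>i. g i x)), (LINT x|M. bary (u x) (\<lambda>i. e i x)))"
proof -
  obtain G :: "'a \<Rightarrow> real" where G: "\<And>x i. x \<in> space M \<Longrightarrow> norm (g i x) \<le> G x"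
    using g by (auto simp: dominated_def)
  obtain H :: "'a \<Rightarrow> real" where H: "\<And>x i. x \<in> space M \<Longrightarrow> norm (e i x) \<le> H x"
    using e by (auto simp: dominated_def)
  have bary_Pair: "bary (u x) (\<lambda>i. (g i x, e i x)) = (bary (u x) (\<lambda>i. g i x), bary (u x) (\<lambda>i. e i x))"
    if x: "x \<in> space M" for x
  proof -
    have "(\<lambda>i. u x i *\<^sub>R g i x) sums bary (u x) (\<lambda>i. g i x)"
      "(\<lambda>i. u x i *\<^sub>R e i x) sums bary (u x) (\<lambda>i. e i x)"
      unfolding bary_def
      by (rule summable_sums[OF simplex_seq_summable[OF simplex_fieldsD(2)[OF u x] G[OF x]]]
        summable_sums[OF simplex_seq_summable[OF simplex_fieldsD(2)[OF u x] H[OF x]]])+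
    then have "(\<lambda>i. (u x i *\<^sub>R g i x, u x i *\<^sub>R e i x)) sums
        (bary (u x) (\<lambda>i. g i x), bary (u x) (\<lambda>i. e i x))"
      unfolding sums_def by (simp add: sum_prod tendsto_Pair)
    then show ?thesis by (simp add: bary_def sums_iff)
  qed
  have int: "integrable M (\<lambda>x. bary (u x) (\<lambda>i. (g i x, e i x)))"
    by (rule integrable_bary[OF u dominated_Pair[OF g e]])
  have "(LINT x|M. bary (u x) (\<lambda>i. g i x)) = (LINT x|M. fst (bary (u x) (\<lambda>i. (g i x, e i x))))"
    "(LINT x|M. bary (u x) (\<lambda>i. e i x)) = (LINT x|M. snd (bary (u x) (\<lambda>i. (g i x, e i x))))"
    by (intro Bochner_Integration.integral_cong; simp add: bary_Pair)+
  then show ?thesis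
    using integral_fst[OF int] integral_snd[OF int] by (simp add: prod_eq_iff)
qed

text \<open>
  Choose \<open>N\<close> such that the coordinates below \<open>N\<close> carry half of the mass over the fractional set. If
  this mass is preserved while these coordinates become integral, half of the set must reach a vertex.
\<close>

lemma (in finite_measure) vertex_step:
  fixes g :: "nat \<Rightarrow> 'a \<Rightarrow> 'b::euclidean_space"
  assumes na: "nonatomic M" and g: "dominated M g" and t: "t \<in> simplex_fields M"
  shows "\<exists>t'\<in>simplex_fields M.
        (LINT x|M. bary (t' x) (\<lambda>i. g i x)) = (LINT x|M. bary (t x) (\<lambda>i. g i x)) \<and>
        (\<forall>x\<in>space M. \<not> (\<exists>i. t x i \<notin> {0, 1}) \<longrightarrow> t' x = t x) \<and>
        (\<forall>x\<in>space M. \<forall>i. t x i = 0 \<longrightarrow> t' x i = 0) \<and>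
        measure M {x \<in> space M. \<exists>i. t' x i \<notin> {0, 1}}
          \<le> 1/2 * measure M {x \<in> space M. \<exists>i. t x i \<notin> {0, 1}}"
proof -
  define F where "F = {x \<in> space M. \<exists>i. t x i \<notin> {0, 1}}"
  have [measurable]: "(\<lambda>x. t x i) \<in> borel_measurable M" "g i \<in> borel_measurable M" for i
    using t g by (auto simp: simplex_fields_def dominated_def)
  have F[measurable]: "F \<in> sets M" unfolding F_def by measurable
  have preserve: "t' x = t x"
    if t': "t' \<in> simplex_fields M" and supp: "\<forall>x\<in>space M. \<forall>i. t x i = 0 \<longrightarrow> t' x i = 0"
      and x: "x \<in> space M" "x \<notin> F" for t' x
  proof -
    obtain k where "t x = vertex k"
      using simplex_seq_01_vertex[OF simplex_fieldsD(2)[OF t x(1)]] x by (auto simp: F_def)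
    moreover from this have "t' x = vertex k"
      using simplex_seq_supported_eq_vertex[OF simplex_fieldsD(2)[OF t' x(1)], of k] supp x
      by (auto simp: vertex_def)
    ultimately show ?thesis by simp
  qed
  have "(\<lambda>N. LINT x|M. indicator F x * (\<Sum>i<N. t x i)) \<longlonglongrightarrow> (LINT x|M. indicator F x * 1)"
  proof (rule integral_dominated_convergence[where w = "\<lambda>_. 1"])
    show "AE x in M. (\<lambda>N. indicator F x * (\<Sum>i<N. t x i)) \<longlonglongrightarrow> indicator F x * 1"
      using simplex_fieldsD(2)[OF t]
      by (intro AE_I2 tendsto_mult_left) (simp add: simplex_seq_def sums_def)
    show "AE x in M. norm (indicator F x * (\<Sum>i<N. t x i)) \<le> 1" for N
    proof (intro AE_I2)
      fix x assume "x \<in> space M"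
      from simplex_fieldsD(2)[OF t this] show "norm (indicator F x * (\<Sum>i<N. t x i)) \<le> 1"
        using simplex_seq_sum_le[of "t x" "{..<N}"] simplex_seq_nonneg[of "t x"]
        by (auto simp: indicator_def abs_mult abs_of_nonneg sum_nonneg)
    qed
  qed auto
  then have lim: "(\<lambda>N. LINT x|M. indicator F x * (\<Sum>i<N. t x i)) \<longlonglongrightarrow> measure M F"
    by simp
  have "\<exists>N. 1/2 * measure M F \<le> (LINT x|M. indicator F x * (\<Sum>i<N. t x i))"
  \<comment> \<open>A null set needs no mass; otherwise half of its measure is strictly below the
    limit and is exceeded for some \<open>N\<close>.\<close>
  proof (cases "measure M F = 0")
    case True
    then show ?thesis by (intro exI[of _ 0]) auto
  next
    case False
    then have "1/2 * measure M F < measure M F" using measure_nonneg[of M F] by linarith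
    from order_tendstoD(1)[OF lim this]
    obtain N where "1/2 * measure M F < (LINT x|M. indicator F x * (\<Sum>i<N. t x i))"
      using eventually_happens'[OF sequentially_bot] by blast
    then show ?thesis by (intro exI[of _ N]) (rule less_imp_le)
  qed
  then obtain N where N: "1/2 * measure M F \<le> (LINT x|M. indicator F x * (\<Sum>i<N. t x i))" by blast
  \<comment> \<open>The barycentre of this family is the mass of the coordinates below
    \<open>N\<close> on \<open>F\<close>, so preserving its integral preserves that mass.\<close>
  define e :: "nat \<Rightarrow> 'a \<Rightarrow> real" where "e i x = (if i < N then indicator F x else 0)" for i x
  have e_bd: "norm (e i x) \<le> 1" for i x by (simp add: e_def indicator_def)
  have e: "dominated M e"
    unfolding dominated_def
  proof (intro conjI allI exI[of _ "\<lambda>_. 1"] ballI e_bd)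
    show "e i \<in> borel_measurable M" for i unfolding e_def by measurable
  qed simp
  have bary_e: "bary a (\<lambda>i. e i x) = indicator F x * (\<Sum>i<N. a i)" for a x
  proof -
    have "(\<lambda>i. a i *\<^sub>R e i x) sums (\<Sum>i<N. a i *\<^sub>R e i x)"
      by (rule sums_finite) (auto simp: e_def)
    then show ?thesis by (simp add: bary_def e_def sum_distrib_left mult.commute sums_iff)
  qed
  obtain t' where t': "t' \<in> simplex_fields M"
    "(LINT x|M. bary (t' x) (\<lambda>i. (g i x, e i x))) = (LINT x|M. bary (t x) (\<lambda>i. (g i x, e i x)))"
    "\<forall>x\<in>space M. \<forall>i. t x i = 0 \<longrightarrow> t' x i = 0" "AE x in M. \<forall>k<N. t' x k \<in> {0, 1}"
    using integral_initial_coordinates[OF na dominated_Pair[OF g e] t, of N] by blast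
  have eq: "(LINT x|M. bary (t' x) (\<lambda>i. g i x)) = (LINT x|M. bary (t x) (\<lambda>i. g i x))"
    and eq2: "(LINT x|M. indicator F x * (\<Sum>i<N. t' x i)) = (LINT x|M. indicator F x * (\<Sum>i<N. t x i))"
    using t'(2) by (simp_all add: integral_bary_Pair[OF t'(1) g e] integral_bary_Pair[OF t g e] bary_e)
  have int: "integrable M (\<lambda>x. indicator F x * (\<Sum>i<N. t' x i))"
    using integrable_bary[OF t'(1) e] by (simp add: bary_e)
  define F' where "F' = {x \<in> space M. \<exists>i. t' x i \<notin> {0, 1}}"
  have [measurable]: "(\<lambda>x. t' x i) \<in> borel_measurable M" for i
    using t' by (auto simp: simplex_fields_def)
  have F'[measurable]: "F' \<in> sets M" unfolding F'_def by measurable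
  have "F' \<subseteq> F"
  proof
    fix x assume x: "x \<in> F'"
    then have "t' x \<noteq> t x" if "x \<notin> F" using that by (auto simp: F'_def F_def)
    then show "x \<in> F" using preserve[OF t'(1,3)] x by (auto simp: F'_def)
  qed
  \<comment> \<open>Once the coordinates below \<open>N\<close> are integral, their sum is nonzero
    only where one of them is 1, hence only at vertices. Points still fractional contribute
    nothing.\<close>
  have "(LINT x|M. indicator F x * (\<Sum>i<N. t' x i)) \<le> (LINT x|M. indicator (F - F') x)"
  proof (rule integral_mono_AE)
    show "AE x in M. indicator F x * (\<Sum>i<N. t' x i) \<le> (indicator (F - F') x :: real)"
      using t'(4) AE_space
    proof eventually_elim
      case (elim x)
      note a = simplex_fieldsD(2)[OF t'(1) elim(2)]
      show ?case
      proof (cases "\<exists>k<N. t' x k = 1")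
        case True
        then obtain k where "t' x = vertex k" using simplex_seq_eq_vertex[OF a] by blast
        then have "x \<notin> F'" by (simp add: F'_def vertex_def)
        then show ?thesis
          using simplex_seq_sum_le[OF a, of "{..<N}"] by (auto simp: indicator_def)
      next
        case False
        then have "(\<Sum>i<N. t' x i) = 0" using elim by (intro sum.neutral) auto
        then show ?thesis by simp
      qed
    qed
    show "integrable M (\<lambda>x. indicator (F - F') x :: real)"
      by (intro integrable_real_indicator) (auto simp: less_top[symmetric])
  qed (use int in auto)
  then have "1/2 * measure M F \<le> measure M (F - F')" using N eq2 by simp
  also have "\<dots> = measure M F - measure M F'"
    using \<open>F' \<subseteq> F\<close> by (intro finite_measure_Diff) auto
  finally have "measure M F' \<le> 1/2 * measure M F" by simp
  then show ?thesis
    using t' eq preserve[OF t'(1,3)] unfolding F_def F'_def by (intro bexI[of _ t']) auto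
qed

theorem (in finite_measure) Lyapunov_selection:
  fixes g :: "nat \<Rightarrow> 'a \<Rightarrow> 'b::euclidean_space"
  assumes na: "nonatomic M" and g: "dominated M g" and t: "t \<in> simplex_fields M"
  shows "\<exists>\<iota>\<in>measurable M (count_space UNIV).
           (LINT x|M. g (\<iota> x) x) = (LINT x|M. bary (t x) (\<lambda>i. g i x))"
proof -
  have "\<exists>t'\<in>simplex_fields M.
        (LINT x|M. bary (t' x) (\<lambda>i. g i x)) = (LINT x|M. bary (t x) (\<lambda>i. g i x)) \<and>
        (\<forall>x\<in>space M. \<forall>i. t x i = 0 \<longrightarrow> t' x i = 0) \<and> (AE x in M. \<not> (\<exists>i. t' x i \<notin> {0, 1}))"
  proof (rule iterate_shrinking[where P = "\<lambda>a. \<exists>i. a i \<notin> {0, 1}" and \<rho> = "1/2", OF g _ _ _ _ t])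
    show "{x \<in> space M. \<exists>i. t x i \<notin> {0, 1}} \<in> sets M" if "t \<in> simplex_fields M" for t
    proof -
      have [measurable]: "(\<lambda>x. t x i) \<in> borel_measurable M" for i using that by (simp add: simplex_fields_def)
      show ?thesis by measurable
    qed
  qed (use vertex_step[OF na g] in auto)
  then obtain t' where t': "t' \<in> simplex_fields M"
      "(LINT x|M. bary (t' x) (\<lambda>i. g i x)) = (LINT x|M. bary (t x) (\<lambda>i. g i x))"
      "AE x in M. \<forall>i. t' x i \<in> {0, 1}" by auto
  \<comment> \<open>Almost everywhere exactly one index qualifies; \<open>LEAST\<close> keeps the
    choice measurable.\<close>
  define \<iota> where "\<iota> x = (LEAST i. t' x i = 1)" for x
  have [measurable]: "(\<lambda>x. t' x i) \<in> borel_measurable M" "g i \<in> borel_measurable M" for i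
    using t' g by (auto simp: simplex_fields_def dominated_def)
  have \<iota>[measurable]: "\<iota> \<in> measurable M (count_space UNIV)"
    unfolding \<iota>_def by measurable
  have "(LINT x|M. bary (t' x) (\<lambda>i. g i x)) = (LINT x|M. g (\<iota> x) x)"
  proof (rule integral_cong_AE)
    show "(\<lambda>x. bary (t' x) (\<lambda>i. g i x)) \<in> borel_measurable M"
      using integrable_bary[OF t'(1) g] by simp
    show "(\<lambda>x. g (\<iota> x) x) \<in> borel_measurable M" by measurable
    show "AE x in M. bary (t' x) (\<lambda>i. g i x) = g (\<iota> x) x"
      using t'(3) AE_space
    proof eventually_elim
      case (elim x)
      then obtain k where k: "t' x = vertex k"
        using simplex_seq_01_vertex[OF simplex_fieldsD(2)[OF t'(1)]] by blast
      then have "\<iota> x = k" unfolding \<iota>_def by (intro Least_equality) (auto simp: vertex_def split: if_splits)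
      then show ?case by (simp add: k bary_vertex)
    qed
  qed
  then show ?thesis using \<iota> t' by auto
qed

text \<open>Half-spaces orthogonal to a fixed basis vector cut \<open>A\<close>. The measure of the
  part cut off is the distribution function of one coordinate, which is continuous because
  hyperplanes are null sets, and the intermediate value theorem applies.\<close>

lemma nonatomic_lebesgue_on:
  fixes K :: "'a::euclidean_space set"
  assumes K: "K \<in> lmeasurable"
  shows "nonatomic (lebesgue_on K)"
  unfolding nonatomic_def
proof (intro ballI allI impI)
  fix A and r :: real
  assume A: "A \<in> sets (lebesgue_on K)" and r: "0 \<le> r \<and> r \<le> measure (lebesgue_on K) A"
  have Kl: "K \<in> sets lebesgue" using K by (simp add: fmeasurable_def)
  have AK: "A \<subseteq> K" "A \<in> sets lebesgue" using A Kl by (auto simp: sets_restrict_space_iff)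
  have Al: "A \<in> lmeasurable" using AK K by (meson fmeasurableI2)
  obtain b :: 'a where b: "b \<in> Basis" using nonempty_Basis by blast
  define N where "N = distr (lebesgue_on A) borel (\<lambda>x. x \<bullet> b)"
  have meas[measurable]: "(\<lambda>x. x \<bullet> b) \<in> borel_measurable (lebesgue_on A)"
    by (intro measurable_restrict_space1 measurable_completion) simp
  interpret L: finite_measure "lebesgue_on A"
    using Al by (intro finite_measureI) (auto simp: emeasure_restrict_space AK fmeasurable_def)
  interpret N: finite_borel_measure N
    unfolding N_def by (intro finite_borel_measure.intro L.finite_measure_distr finite_borel_measure_axioms.intro) auto
  have cdf: "cdf N s = measure lebesgue {x \<in> A. x \<bullet> b \<le> s}" for s
  proof -
    have "cdf N s = measure (lebesgue_on A) ((\<lambda>x. x \<bullet> b) -` {..s} \<inter> space (lebesgue_on A))"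
      unfolding cdf_def N_def by (intro measure_distr) auto
    also have "(\<lambda>x. x \<bullet> b) -` {..s} \<inter> space (lebesgue_on A) = {x \<in> A. x \<bullet> b \<le> s}" by auto
    also have "measure (lebesgue_on A) {x \<in> A. x \<bullet> b \<le> s} = measure lebesgue {x \<in> A. x \<bullet> b \<le> s}"
      using AK by (intro measure_restrict_space) auto
    finally show ?thesis .
  qed
  have "isCont (cdf N) s" for s
  proof -
    have "measure N {s} = measure (lebesgue_on A) {x \<in> A. x \<bullet> b = s}"
      unfolding N_def by (subst measure_distr) (auto intro!: arg_cong[where f = "measure _"])
    also have "\<dots> = measure lebesgue {x \<in> A. x \<bullet> b = s}"
      using AK by (intro measure_restrict_space) auto
    also have "\<dots> = 0"
    proof -
      have "negligible {x. x \<bullet> b = s}"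
        using negligible_standard_hyperplane[OF b, of s] by (simp add: inner_commute)
      then have "negligible {x \<in> A. x \<bullet> b = s}" by (rule negligible_subset) auto
      then show ?thesis by (simp add: negligible_iff_measure)
    qed
    finally show ?thesis by (simp add: N.isCont_cdf)
  qed
  then have cont: "continuous_on UNIV (cdf N)" by (simp add: continuous_on_eq_continuous_at)
  have top: "measure N (space N) = measure lebesgue A"
    unfolding N_def using AK by (subst measure_distr) (auto simp: measure_restrict_space)
  have rA: "r \<le> measure lebesgue A"
    using r AK Kl by (simp add: measure_restrict_space)
  have "\<exists>B. B \<in> sets lebesgue \<and> B \<subseteq> A \<and> measure lebesgue B = r"
  \<comment> \<open>The distribution function may reach its two extreme values only in the limit at
    infinity, so these are realized by the empty set and by \<open>A\<close>.\<close>
  proof (cases "r = 0 \<or> r = measure lebesgue A")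
    case True
    then show ?thesis
      using AK by (metis empty_subsetI measure_empty order_refl sets.empty_sets)
  next
    case False
    then have r': "0 < r" "r < measure N (space N)" using r rA top by auto
    obtain u where u: "cdf N u < r"
      using order_tendstoD(2)[OF N.cdf_lim_at_bot r'(1)] by (auto simp: eventually_at_bot_linorder)
    obtain v where v: "r < cdf N v"
      using order_tendstoD(1)[OF N.cdf_lim_at_top r'(2)] by (auto simp: eventually_at_top_linorder)
    have "u \<le> v" using N.cdf_nondecreasing[of v u] u v by linarith
    then obtain s where "cdf N s = r"
      using IVT'[of "cdf N" u r v] u v continuous_on_subset[OF cont] by auto
    moreover have "{x \<in> A. x \<bullet> b \<le> s} \<in> sets lebesgue"
    proof -
      have "{x \<in> A. x \<bullet> b \<le> s} = A \<inter> {x. x \<bullet> b \<le> s}" by auto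
      also have "\<dots> \<in> sets lebesgue"
        using AK(2) by (intro sets.Int) (auto simp: borel_closed closed_halfspace_le inner_commute)
      finally show ?thesis .
    qed
    ultimately show ?thesis by (intro exI[of _ "{x \<in> A. x \<bullet> b \<le> s}"]) (auto simp: cdf)
  qed
  then obtain B where B: "B \<in> sets lebesgue" "B \<subseteq> A" "measure lebesgue B = r" by blast
  then show "\<exists>B\<in>sets (lebesgue_on K). B \<subseteq> A \<and> measure (lebesgue_on K) B = r"
    using AK Kl by (intro bexI[of _ B]) (auto simp: sets_restrict_space_iff measure_restrict_space)
qed

section \<open>Generic well-posedness\<close>

definition feasible :: "'a measure \<Rightarrow> (nat \<Rightarrow> 'a \<Rightarrow> 'b::{banach, second_countable_topology}) \<Rightarrow> 'b
    \<Rightarrow> ('a \<Rightarrow> nat \<Rightarrow> real) set"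
  where "feasible M f \<alpha> = {t \<in> simplex_fields M. (LINT x|M. bary (t x) (\<lambda>i. f i x)) = \<alpha>}"

definition value_of :: "'a measure \<Rightarrow> ('a \<Rightarrow> nat \<Rightarrow> real) \<Rightarrow> ('a \<Rightarrow> nat \<Rightarrow> real) \<Rightarrow> real"
  where "value_of M v t = (LINT x|M. bary (t x) (v x))"

definition pure :: "('a \<Rightarrow> nat) \<Rightarrow> 'a \<Rightarrow> nat \<Rightarrow> real"
  where "pure \<iota> x = vertex (\<iota> x)"

text \<open>
  The last integral is half the distance of \<open>t\<close> and \<open>pure \<iota>\<close> in \<open>L\<^sup>1(M, \<ell>\<^sup>1)\<close>.
\<close>

definition concentrated :: "'a measure \<Rightarrow> (nat \<Rightarrow> 'a \<Rightarrow> 'b::{banach, second_countable_topology}) \<Rightarrow> 'b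
    \<Rightarrow> real \<Rightarrow> ('a \<Rightarrow> nat \<Rightarrow> real) \<Rightarrow> bool"
  where "concentrated M f \<alpha> r v \<longleftrightarrow> (\<exists>c. \<exists>\<iota>\<in>measurable M (count_space UNIV).
           pure \<iota> \<in> feasible M f \<alpha> \<and> value_of M v (pure \<iota>) < c \<and>
           (\<forall>t\<in>feasible M f \<alpha>. value_of M v t \<le> c \<longrightarrow> (LINT x|M. 1 - t x (\<iota> x)) \<le> r))"

lemma pure_in_simplex_fields:
  assumes [measurable]: "\<iota> \<in> measurable M (count_space UNIV)"
  shows "pure \<iota> \<in> simplex_fields M"
  unfolding simplex_fields_def pure_def
proof (intro CollectI conjI allI ballI vertex_in_simplex_seq)
  show "(\<lambda>x. vertex (\<iota> x) i) \<in> borel_measurable M" for i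
    unfolding vertex_def by measurable
qed

lemma bary_pure [simp]: "bary (pure \<iota> x) b = b (\<iota> x)"
  by (simp add: pure_def bary_vertex)

lemma measurable_selected_coordinate [measurable (raw)]:
  assumes "t \<in> simplex_fields M" and [measurable]: "\<iota> \<in> measurable M (count_space UNIV)"
  shows "(\<lambda>x. t x (\<iota> x)) \<in> borel_measurable M"
proof -
  have [measurable]: "(\<lambda>x. t x i) \<in> borel_measurable M" for i
    using assms by (simp add: simplex_fields_def)
  show ?thesis by measurable
qed

lemma integrable_selected_coordinate:
  assumes "finite_measure M" "t \<in> simplex_fields M" "\<iota> \<in> measurable M (count_space UNIV)"
  shows "integrable M (\<lambda>x. t x (\<iota> x))"
proof -
  interpret finite_measure M by fact
  show ?thesis
    by (rule integrable_const_bound[where B = 1])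
       (use simplex_fieldsD(2)[OF assms(2)] simplex_seq_nonneg simplex_seq_le_1
          measurable_selected_coordinate[OF assms(2,3)] in auto)
qed

text \<open>The factor \<open>2 * (1 - a k)\<close> is the l1 distance of \<open>a\<close> and
  \<open>vertex k\<close>: what entry \<open>k\<close> lacks is exactly what the other entries
  carry.\<close>

lemma norm_bary_diff_vertex_le:
  fixes b :: "nat \<Rightarrow> 'b::banach"
  assumes a: "a \<in> simplex_seq" and b: "\<And>i. norm (b i) \<le> B"
  shows "norm (bary a b - b k) \<le> 2 * (1 - a k) * B"
proof -
  \<comment> \<open>The absolute differences written without absolute values: only entry
    \<open>k\<close> has the wrong sign, and the correction there is \<open>2 * (1 - a k)\<close>.
    The series then sums termwise.\<close>
  let ?d = "\<lambda>i. a i - vertex k i + 2 * (1 - a k) * vertex k i"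
  have d: "?d sums (1 - 1 + 2 * (1 - a k) * 1)"
    using a by (intro sums_add sums_diff sums_mult vertex_sums) (auto simp: simplex_seq_def)
  have abs_d: "\<bar>a i - vertex k i\<bar> = ?d i" for i
    using simplex_seq_nonneg[OF a, of i] simplex_seq_le_1[OF a, of i] by (auto simp: vertex_def)
  have "(\<lambda>i. a i *\<^sub>R b i - vertex k i *\<^sub>R b i) sums (bary a b - bary (vertex k) b)"
    unfolding bary_def
    by (intro sums_diff summable_sums simplex_seq_summable[OF a b]
        simplex_seq_summable[OF vertex_in_simplex_seq b])
  then have *: "bary a b - b k = (\<Sum>i. (a i - vertex k i) *\<^sub>R b i)"
    by (simp add: sums_iff bary_vertex scaleR_diff_left)
  have le: "norm ((a i - vertex k i) *\<^sub>R b i) \<le> ?d i * B" for i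
    using mult_left_mono[OF b abs_ge_zero[of "a i - vertex k i"]] unfolding norm_scaleR abs_d .
  have "norm (bary a b - b k) \<le> (\<Sum>i. ?d i * B)"
    unfolding * by (intro suminf_le_const norm_suminf_le le summable_mult2 sums_summable[OF d])
  also have "\<dots> = 2 * (1 - a k) * B"
    using suminf_mult2[OF sums_summable[OF d], of B] d by (simp add: sums_iff)
  finally show ?thesis .
qed

text \<open>Integrating the series termwise shows that it converges almost everywhere, so its terms
  vanish in the limit. Thus summable radii give pointwise convergence without passing to a
  subsequence.\<close>

lemma AE_tendsto_0_of_summable_integrals:
  fixes h :: "nat \<Rightarrow> 'a \<Rightarrow> real"
  assumes int: "\<And>k. integrable M (h k)" and nonneg: "\<And>k x. x \<in> space M \<Longrightarrow> 0 \<le> h k x"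
    and le: "\<And>k. (LINT x|M. h k x) \<le> c k" and c: "summable c"
  shows "AE x in M. (\<lambda>k. h k x) \<longlonglongrightarrow> 0"
proof -
  have [measurable]: "h k \<in> borel_measurable M" for k using int[of k] by simp
  have "(\<integral>\<^sup>+x. (\<Sum>k. ennreal (h k x)) \<partial>M) = (\<Sum>k. \<integral>\<^sup>+x. ennreal (h k x) \<partial>M)"
    by (rule nn_integral_suminf) auto
  also have "\<dots> = (\<Sum>k. ennreal (LINT x|M. h k x))"
    using int nonneg by (intro arg_cong[where f = suminf] ext nn_integral_eq_integral) auto
  also have "\<dots> < \<infinity>"
  proof -
    have "0 \<le> (LINT x|M. h k x)" for k using nonneg by (intro Bochner_Integration.integral_nonneg) auto
    moreover from this have "summable (\<lambda>k. LINT x|M. h k x)"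
      using le by (intro summable_comparison_test'[OF c]) auto
    ultimately show ?thesis by (simp add: suminf_ennreal2)
  qed
  finally have "AE x in M. (\<Sum>k. ennreal (h k x)) \<noteq> \<infinity>"
    by (intro nn_integral_noteq_infinite) auto
  then show ?thesis
    using AE_space
  proof eventually_elim
    case (elim x)
    then have "summable (\<lambda>k. h k x)"
      using nonneg by (intro summable_suminf_not_top) auto
    then show ?case by (rule summable_LIMSEQ_zero)
  qed
qed

section \<open>The abstract problem and its solution under concentration at all scales\<close>

locale relaxed_problem = finite_measure M for M :: "'a measure" +
  fixes f :: "nat \<Rightarrow> 'a \<Rightarrow> 'b::euclidean_space" and \<alpha> :: 'b
  assumes nonatomic: "nonatomic M" and dominated_f: "dominated M f"
    and feasible_nonempty: "feasible M f \<alpha> \<noteq> {}"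
begin

abbreviation "Adm \<equiv> feasible M f \<alpha>"

lemma Adm_simplex_fields: "t \<in> Adm \<Longrightarrow> t \<in> simplex_fields M"
  by (simp add: feasible_def)

text \<open>Lyapunov's theorem is applied to the pairs of \<open>f\<close> and \<open>v\<close>, so
  that constraint and cost are kept by the same selection.\<close>

lemma exists_pure_same_value:
  assumes v: "dominated M (\<lambda>i x. v x i)" and t: "t \<in> Adm"
  shows "\<exists>\<iota>\<in>measurable M (count_space UNIV). pure \<iota> \<in> Adm \<and> value_of M v (pure \<iota>) = value_of M v t"
proof -
  note t' = Adm_simplex_fields[OF t]
  obtain \<iota> where \<iota>: "\<iota> \<in> measurable M (count_space UNIV)"
    "(LINT x|M. (f (\<iota> x) x, v x (\<iota> x))) = (LINT x|M. bary (t x) (\<lambda>i. (f i x, v x i)))"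
    using Lyapunov_selection[OF nonatomic dominated_Pair[OF dominated_f v] t'] by blast
  have "(LINT x|M. (f (\<iota> x) x, v x (\<iota> x))) = (LINT x|M. bary (pure \<iota> x) (\<lambda>i. (f i x, v x i)))"
    by simp
  then have "((LINT x|M. bary (pure \<iota> x) (\<lambda>i. f i x)), (LINT x|M. bary (pure \<iota> x) (v x))) =
      ((LINT x|M. bary (t x) (\<lambda>i. f i x)), (LINT x|M. bary (t x) (v x)))"
    using \<iota>(2) integral_bary_Pair[OF t' dominated_f v]
      integral_bary_Pair[OF pure_in_simplex_fields[OF \<iota>(1)] dominated_f v] by simp
  then show ?thesis
    using \<iota>(1) t pure_in_simplex_fields[OF \<iota>(1)]
    by (intro bexI[of _ \<iota>]) (auto simp: feasible_def value_of_def)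
qed

lemma value_bdd_below:
  assumes v: "dominated M (\<lambda>i x. v x i)"
  shows "bdd_below (value_of M v ` Adm)"
proof -
  obtain G where G: "integrable M G" "\<And>x i. x \<in> space M \<Longrightarrow> norm (v x i) \<le> G x"
    using v by (auto simp: dominated_def)
  have "- (LINT x|M. G x) \<le> value_of M v t" if "t \<in> Adm" for t
  proof -
    note t = Adm_simplex_fields[OF that]
    have "(LINT x|M. - G x) \<le> value_of M v t"
      unfolding value_of_def
    proof (rule integral_mono)
      show "- G x \<le> bary (t x) (v x)" if "x \<in> space M" for x
        using norm_bary_le[where b = "v x", OF simplex_fieldsD(2)[OF t that] G(2)[OF that]] by simp
    qed (use G integrable_bary[OF t v] in auto)
    then show ?thesis by simp
  qed
  then show ?thesis by (meson bdd_below.I2)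
qed

text \<open>Level \<open>k\<close> controls both \<open>\<psi> k\<close> and
  \<open>\<psi> (Suc k)\<close>, so almost everywhere both eventually put more than half of their
  mass on \<open>j k x\<close>. Consecutive indices must then agree, the selections
  \<open>j k\<close> stabilize, and the minimizing sequence converges to a vertex; dominated
  convergence transfers constraint and cost.\<close>

lemma unique_minimizer_of_concentrated:
  assumes v: "dominated M (\<lambda>i x. v x i)" and conc: "\<And>k::nat. concentrated M f \<alpha> ((1/2) ^ k) v"
  shows "\<exists>\<iota>\<in>measurable M (count_space UNIV). pure \<iota> \<in> Adm \<and>
           (\<forall>t\<in>Adm. value_of M v (pure \<iota>) \<le> value_of M v t) \<and>
           (\<forall>t\<in>Adm. value_of M v t \<le> value_of M v (pure \<iota>) \<longrightarrow> (AE x in M. t x = pure \<iota> x))"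
proof -
  define p where "p = Inf (value_of M v ` Adm)"
  have p_le: "p \<le> value_of M v t" if "t \<in> Adm" for t
    unfolding p_def using value_bdd_below[OF v] that by (intro cInf_lower) auto
  have "\<forall>k. \<exists>c \<iota>. \<iota> \<in> measurable M (count_space UNIV) \<and> pure \<iota> \<in> Adm \<and> value_of M v (pure \<iota>) < c \<and>
           (\<forall>t\<in>Adm. value_of M v t \<le> c \<longrightarrow> (LINT x|M. 1 - t x (\<iota> x)) \<le> (1/2) ^ k)"
    using conc unfolding concentrated_def by blast
  then obtain c j where j[measurable]: "\<And>k::nat. j k \<in> measurable M (count_space UNIV)"
    and c: "\<And>k. pure (j k) \<in> Adm" "\<And>k. value_of M v (pure (j k)) < c k"
    and near: "\<And>k t. t \<in> Adm \<Longrightarrow> value_of M v t \<le> c k \<Longrightarrow> (LINT x|M. 1 - t x (j k x)) \<le> (1/2) ^ k"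
    by metis
  have p_c: "p < c k" for k using p_le[OF c(1)] c(2) by (meson le_less_trans)
  \<comment> \<open>The minimum over all earlier levels makes each term of the sequence a
    near-minimizer for every level up to its own index; the other bound makes the sequence
    minimizing.\<close>
  have "\<exists>t\<in>Adm. value_of M v t < min (Min (c ` {..k})) (p + 1 / real (Suc k))" for k
  proof -
    have "p < min (Min (c ` {..k})) (p + 1 / real (Suc k))" using p_c by simp
    then show ?thesis
      using cInf_lessD[of "value_of M v ` Adm" "min (Min (c ` {..k})) (p + 1 / real (Suc k))"]
        feasible_nonempty by (simp only: p_def[symmetric] image_is_empty bex_simps) blast
  qed
  then obtain \<psi> where \<psi>: "\<And>k. \<psi> k \<in> Adm"
    and \<psi>_less: "\<And>k. value_of M v (\<psi> k) < min (Min (c ` {..k})) (p + 1 / real (Suc k))" by metis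
  note \<psi>_fields = Adm_simplex_fields[OF \<psi>]
  have \<psi>_c: "value_of M v (\<psi> l) \<le> c k" if "k \<le> l" for k l
    using \<psi>_less[of l] that by (auto intro: less_imp_le)
  have int: "integrable M (\<lambda>x. 1 - t x (j k x))" if "t \<in> simplex_fields M" for t k
    using integrable_selected_coordinate[OF finite_measure_axioms that j] by simp
  have nonneg: "0 \<le> 1 - t x i" if "t \<in> simplex_fields M" "x \<in> space M" for t x i
    using simplex_seq_le_1[OF simplex_fieldsD(2)[OF that]] by simp
  have geo: "summable (\<lambda>k. (1/2::real) ^ k)" by (simp add: summable_geometric)
  have lim_1: "AE x in M. (\<lambda>k. 1 - u k x (j k x)) \<longlonglongrightarrow> 0"
    if "\<And>k. u k \<in> Adm" "\<And>k. value_of M v (u k) \<le> c k" for u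
  proof (rule AE_tendsto_0_of_summable_integrals[OF _ _ _ geo])
    show "integrable M (\<lambda>x. 1 - u k x (j k x))" for k by (rule int[OF Adm_simplex_fields[OF that(1)]])
    show "0 \<le> 1 - u k x (j k x)" if "x \<in> space M" for k x
      by (rule nonneg[OF Adm_simplex_fields[OF \<open>\<And>k. u k \<in> Adm\<close>] that])
    show "(LINT x|M. 1 - u k x (j k x)) \<le> (1/2) ^ k" for k by (rule near[OF that])
  qed
  have "AE x in M. (\<lambda>k. 1 - \<psi> k x (j k x)) \<longlonglongrightarrow> 0" "AE x in M. (\<lambda>k. 1 - \<psi> (Suc k) x (j k x)) \<longlonglongrightarrow> 0"
    by (intro lim_1 \<psi> \<psi>_c; simp)+
  then have const: "AE x in M. \<exists>i. (\<exists>N. \<forall>k\<ge>N. j k x = i) \<and> (\<lambda>k. 1 - \<psi> k x i) \<longlonglongrightarrow> 0"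
    using AE_space
  proof eventually_elim
    case (elim x)
    have "eventually (\<lambda>k. 1 - \<psi> k x (j k x) < 1/2) sequentially"
      "eventually (\<lambda>k. 1 - \<psi> (Suc k) x (j k x) < 1/2) sequentially"
      by (rule order_tendstoD(2)[OF elim(1)] order_tendstoD(2)[OF elim(2)], simp)+
    then obtain N where N: "\<And>k. k \<ge> N \<Longrightarrow> 1 - \<psi> k x (j k x) < 1/2 \<and> 1 - \<psi> (Suc k) x (j k x) < 1/2"
      unfolding eventually_sequentially by (meson nle_le order_trans)
    \<comment> \<open>Two different indices cannot both carry more than half of the mass of
      \<open>\<psi> (Suc k) x\<close>.\<close>
    have step: "j (Suc k) x = j k x" if "k \<ge> N" for k
    proof (rule ccontr)
      assume "j (Suc k) x \<noteq> j k x"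
      then have "\<psi> (Suc k) x (j (Suc k) x) + \<psi> (Suc k) x (j k x) \<le> 1"
        using simplex_seq_sum_le[OF simplex_fieldsD(2)[OF \<psi>_fields elim(3)], of "{j (Suc k) x, j k x}" "Suc k"]
        by simp
      then show False using N[of k] N[of "Suc k"] that by simp
    qed
    have eq: "j k x = j N x" if "k \<ge> N" for k
      using that by (induction k rule: dec_induct) (auto simp: step)
    have "eventually (\<lambda>k. 1 - \<psi> k x (j k x) = 1 - \<psi> k x (j N x)) sequentially"
      by (rule eventually_sequentiallyI[of N]) (metis eq)
    then have "(\<lambda>k. 1 - \<psi> k x (j N x)) \<longlonglongrightarrow> 0"
      by (rule Lim_transform_eventually[OF elim(1)])
    then show ?case using eq by blast
  qed
  define \<iota> where "\<iota> x = (LEAST i. \<exists>N. \<forall>k. k \<ge> N \<longrightarrow> j k x = i)" for x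
  have \<iota>[measurable]: "\<iota> \<in> measurable M (count_space UNIV)" unfolding \<iota>_def by measurable
  have \<iota>_eq: "\<iota> x = i" if "\<exists>N. \<forall>k\<ge>N. j k x = i" for x i
    unfolding \<iota>_def
  proof (rule Least_equality)
    show "i \<le> i'" if "\<exists>N. \<forall>k\<ge>N. j k x = i'" for i'
      using that \<open>\<exists>N. \<forall>k\<ge>N. j k x = i\<close> by (metis nle_le order_refl)
  qed (use that in auto)
  have \<iota>_lim: "AE x in M. (\<exists>N. \<forall>k\<ge>N. j k x = \<iota> x) \<and> (\<lambda>k. 1 - \<psi> k x (\<iota> x)) \<longlonglongrightarrow> 0"
    using const by eventually_elim (use \<iota>_eq in blast)
  note \<iota>_fields = pure_in_simplex_fields[OF \<iota>]
  have lim_int: "(\<lambda>k. LINT x|M. bary (\<psi> k x) (\<lambda>i. g i x)) \<longlonglongrightarrow> (LINT x|M. bary (pure \<iota> x) (\<lambda>i. g i x))"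
    if g: "dominated M g" for g :: "nat \<Rightarrow> 'a \<Rightarrow> 'c::euclidean_space"
  proof -
    obtain G :: "'a \<Rightarrow> real" where G: "integrable M G" "\<And>x i. x \<in> space M \<Longrightarrow> norm (g i x) \<le> G x"
      using g by (auto simp: dominated_def)
    show ?thesis
    proof (rule integral_dominated_convergence[OF _ _ G(1)])
      show "AE x in M. (\<lambda>k. bary (\<psi> k x) (\<lambda>i. g i x)) \<longlonglongrightarrow> bary (pure \<iota> x) (\<lambda>i. g i x)"
        using \<iota>_lim AE_space
      proof eventually_elim
        case (elim x)
        have "(\<lambda>k. bary (\<psi> k x) (\<lambda>i. g i x) - g (\<iota> x) x) \<longlonglongrightarrow> 0"
        proof (rule Lim_null_comparison)
          show "eventually (\<lambda>k. norm (bary (\<psi> k x) (\<lambda>i. g i x) - g (\<iota> x) x)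
              \<le> 2 * (1 - \<psi> k x (\<iota> x)) * G x) sequentially"
            using norm_bary_diff_vertex_le[OF simplex_fieldsD(2)[OF \<psi>_fields elim(2)], where b = "\<lambda>i. g i x"]
              G(2)[OF elim(2)] by (intro always_eventually) blast
          show "(\<lambda>k. 2 * (1 - \<psi> k x (\<iota> x)) * G x) \<longlonglongrightarrow> 0"
            using tendsto_mult_left[OF conjunct2[OF elim(1)], of "2 * G x"] by (simp add: mult_ac)
        qed
        then show ?case by (simp add: LIM_zero_iff)
      qed
      show "AE x in M. norm (bary (\<psi> k x) (\<lambda>i. g i x)) \<le> G x" for k
        using norm_bary_le[OF simplex_fieldsD(2)[OF \<psi>_fields] G(2)] by auto
    qed (intro borel_measurable_integrable integrable_bary \<psi>_fields \<iota>_fields g)+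
  qed
  have "(LINT x|M. bary (pure \<iota> x) (\<lambda>i. f i x)) = \<alpha>"
    using lim_int[OF dominated_f] \<psi> by (simp add: feasible_def LIMSEQ_const_iff)
  then have \<iota>_Adm: "pure \<iota> \<in> Adm" using \<iota>_fields by (simp add: feasible_def)
  have "(\<lambda>k. value_of M v (\<psi> k)) \<longlonglongrightarrow> value_of M v (pure \<iota>)"
    using lim_int[OF v] by (simp add: value_of_def)
  moreover have "(\<lambda>k. value_of M v (\<psi> k)) \<longlonglongrightarrow> p"
  proof (rule tendsto_sandwich[OF always_eventually always_eventually tendsto_const])
    show "\<forall>k. p \<le> value_of M v (\<psi> k)" using p_le[OF \<psi>] by blast
    show "\<forall>k. value_of M v (\<psi> k) \<le> p + 1 / real (Suc k)" using \<psi>_less by (simp add: less_imp_le)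
    show "(\<lambda>k. p + 1 / real (Suc k)) \<longlonglongrightarrow> p"
      using tendsto_add[OF tendsto_const LIMSEQ_Suc[OF lim_1_over_n], of p] by simp
  qed
  ultimately have value_\<iota>: "value_of M v (pure \<iota>) = p" by (rule LIMSEQ_unique)
  have "AE x in M. t x = pure \<iota> x" if t: "t \<in> Adm" "value_of M v t \<le> value_of M v (pure \<iota>)" for t
  proof -
    \<comment> \<open>A minimizer lies below every level \<open>c k\<close>, so it enters
      \<open>lim_1\<close> as a constant sequence.\<close>
    have "AE x in M. (\<lambda>k. 1 - t x (j k x)) \<longlonglongrightarrow> 0"
      using t p_c by (intro lim_1) (auto simp: value_\<iota> intro: less_imp_le le_less_trans)
    then show ?thesis
      using \<iota>_lim AE_space
    proof eventually_elim
      case (elim x)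
      then obtain N where N: "\<And>k. k \<ge> N \<Longrightarrow> j k x = \<iota> x" by blast
      have "eventually (\<lambda>k. 1 - t x (j k x) = 1 - t x (\<iota> x)) sequentially"
        by (rule eventually_sequentiallyI[of N]) (simp add: N)
      then have "(\<lambda>k::nat. 1 - t x (\<iota> x)) \<longlonglongrightarrow> 0"
        by (rule Lim_transform_eventually[OF elim(1)])
      then have "t x (\<iota> x) = 1" by (simp add: LIMSEQ_const_iff)
      then show ?case
        using simplex_seq_eq_vertex[OF simplex_fieldsD(2)[OF Adm_simplex_fields[OF t(1)] elim(3)]]
        by (simp add: pure_def)
    qed
  qed
  then show ?thesis using \<iota> \<iota>_Adm p_le value_\<iota> by (intro bexI[of _ \<iota>]) auto
qed

section \<open>Concentration is an open condition and holds after small perturbations\<close>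

lemma value_of_diff_le:
  assumes v: "dominated M (\<lambda>i x. v x i)" and v': "dominated M (\<lambda>i x. v' x i)" and t: "t \<in> Adm"
    and le: "\<And>x i. x \<in> space M \<Longrightarrow> \<bar>v x i - v' x i\<bar> \<le> e"
  shows "\<bar>value_of M v t - value_of M v' t\<bar> \<le> e * measure M (space M)"
proof -
  note t' = Adm_simplex_fields[OF t]
  obtain G G' where G: "\<And>x i. x \<in> space M \<Longrightarrow> norm (v x i) \<le> G x" "\<And>x i. x \<in> space M \<Longrightarrow> norm (v' x i) \<le> G' x"
    using v v' unfolding dominated_def by metis
  have "\<bar>bary (t x) (v x) - bary (t x) (v' x)\<bar> \<le> e" if x: "x \<in> space M" for x
  proof -
    note a = simplex_fieldsD(2)[OF t' x]
    have "summable (\<lambda>i. t x i *\<^sub>R v x i)" "summable (\<lambda>i. t x i *\<^sub>R v' x i)"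
      by (rule simplex_seq_summable[OF a G(1)[OF x]] simplex_seq_summable[OF a G(2)[OF x]])+
    then have "bary (t x) (v x) - bary (t x) (v' x) = bary (t x) (\<lambda>i. v x i - v' x i)"
      unfolding bary_def scaleR_diff_right by (rule suminf_diff)
    then show ?thesis using norm_bary_le[OF a, of "\<lambda>i. v x i - v' x i" e] le[OF x] by simp
  qed
  moreover have int: "integrable M (\<lambda>x. bary (t x) (v x))" "integrable M (\<lambda>x. bary (t x) (v' x))"
    using integrable_bary[OF t' v] integrable_bary[OF t' v'] by auto
  ultimately have "\<bar>LINT x|M. bary (t x) (v x) - bary (t x) (v' x)\<bar> \<le> (LINT x|M. e)"
    by (intro order_trans[OF integral_abs_bound] integral_mono) auto
  then show ?thesis using int by (simp add: value_of_def mult.commute)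
qed

text \<open>A third of the strict gap below \<open>c\<close> bounds the change of all values.
  Lowering the threshold by another third keeps the selection strictly below it, while everything
  under the new threshold was under the old one for \<open>v\<close>.\<close>

lemma concentrated_open:
  assumes v: "dominated M (\<lambda>i x. v x i)" and conc: "concentrated M f \<alpha> r v"
  shows "\<exists>e>0. \<forall>v'. dominated M (\<lambda>i x. v' x i) \<longrightarrow> (\<forall>x\<in>space M. \<forall>i. \<bar>v x i - v' x i\<bar> \<le> e) \<longrightarrow>
           concentrated M f \<alpha> r v'"
proof -
  obtain c \<iota> where \<iota>: "\<iota> \<in> measurable M (count_space UNIV)" "pure \<iota> \<in> Adm" "value_of M v (pure \<iota>) < c"
    and near: "\<And>t. t \<in> Adm \<Longrightarrow> value_of M v t \<le> c \<Longrightarrow> (LINT x|M. 1 - t x (\<iota> x)) \<le> r"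
    using conc unfolding concentrated_def by blast
  \<comment> \<open>The summand 1 keeps the divisor positive for a null space.\<close>
  define m where "m = measure M (space M) + 1"
  have m: "0 < m" "measure M (space M) \<le> m" by (auto simp: m_def add_nonneg_pos)
  define \<gamma> where "\<gamma> = (c - value_of M v (pure \<iota>)) / 3"
  have \<gamma>: "\<gamma> > 0" using \<iota> by (simp add: \<gamma>_def)
  have "concentrated M f \<alpha> r v'"
    if v': "dominated M (\<lambda>i x. v' x i)" and le: "\<forall>x\<in>space M. \<forall>i. \<bar>v x i - v' x i\<bar> \<le> \<gamma> / m" for v'
  proof -
    have close: "\<bar>value_of M v t - value_of M v' t\<bar> \<le> \<gamma>" if "t \<in> Adm" for t
    proof -
      have "\<bar>value_of M v t - value_of M v' t\<bar> \<le> \<gamma> / m * measure M (space M)"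
        using le by (intro value_of_diff_le v v' that) auto
      also have "\<dots> \<le> \<gamma> / m * m" using m \<gamma> by (intro mult_left_mono) auto
      finally show ?thesis using m by simp
    qed
    have "value_of M v' (pure \<iota>) < c - \<gamma>"
    proof -
      have "c = value_of M v (pure \<iota>) + 3 * \<gamma>" by (simp add: \<gamma>_def field_simps)
      then show ?thesis using close[OF \<iota>(2)] \<gamma> by linarith
    qed
    moreover have "(LINT x|M. 1 - t x (\<iota> x)) \<le> r" if "t \<in> Adm" "value_of M v' t \<le> c - \<gamma>" for t
      using near[OF that(1)] close[OF that(1)] that(2) by (simp add: abs_le_iff)
    ultimately show ?thesis using \<iota> unfolding concentrated_def by blast
  qed
  then show ?thesis using \<gamma> m by (intro exI[of _ "\<gamma> / m"]) auto
qed

text \<open>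
  Subtracting a small multiple of (an approximation of) a pure near-minimizer from the cost penalizes
  the distance to it, since \<open>\<Sum>i. t x i * vertex k i = t x k\<close>. This is where bang-bang
  near-minimizers, hence Lyapunov's theorem, enter.
\<close>

lemma concentrated_dense:
  assumes v: "dominated M (\<lambda>i x. v x i)" and \<delta>: "0 < \<delta>" and r: "0 < r"
  shows "\<exists>\<iota>\<in>measurable M (count_space UNIV). \<exists>\<kappa>>0. \<forall>w C. dominated M (\<lambda>i x. w x i) \<longrightarrow> C \<in> sets M \<longrightarrow>
           measure M (space M - C) \<le> \<kappa> \<longrightarrow> (\<forall>x\<in>space M. \<forall>i. 0 \<le> w x i \<and> w x i \<le> 1) \<longrightarrow>
           (\<forall>x\<in>C. w x = vertex (\<iota> x)) \<longrightarrow> concentrated M f \<alpha> r (\<lambda>x i. v x i - \<delta> * w x i)"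
proof -
  \<comment> \<open>The final estimate reads
    \<open>\<delta> * e \<le> 2 * \<eta> + 2 * (\<delta> * \<kappa>)\<close>; these choices make
    both summands equal to \<open>\<delta> * r / 2\<close>.\<close>
  define \<kappa> where "\<kappa> = r / 4"
  define \<eta> where "\<eta> = \<delta> * r / 4"
  have pos: "\<kappa> > 0" "\<eta> > 0" using \<delta> r by (auto simp: \<kappa>_def \<eta>_def)
  define p where "p = Inf (value_of M v ` Adm)"
  have p_le: "p \<le> value_of M v t" if "t \<in> Adm" for t
    unfolding p_def using value_bdd_below[OF v] that by (intro cInf_lower) auto
  obtain t0 where t0: "t0 \<in> Adm" "value_of M v t0 < p + \<eta>"
    using cInf_lessD[of "value_of M v ` Adm" "p + \<eta>"] feasible_nonempty pos unfolding p_def by force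
  obtain \<iota> where \<iota>: "\<iota> \<in> measurable M (count_space UNIV)" "pure \<iota> \<in> Adm"
    "value_of M v (pure \<iota>) = value_of M v t0"
    using exists_pure_same_value[OF v t0(1)] by blast
  define \<mu> where "\<mu> = measure M (space M)"
  have "concentrated M f \<alpha> r (\<lambda>x i. v x i - \<delta> * w x i)"
    if w: "dominated M (\<lambda>i x. w x i)" and C[measurable]: "C \<in> sets M" and small: "measure M (space M - C) \<le> \<kappa>"
      and w01: "\<forall>x\<in>space M. \<forall>i. 0 \<le> w x i \<and> w x i \<le> 1" and wC: "\<forall>x\<in>C. w x = vertex (\<iota> x)" for w C
  proof -
    have sub: "value_of M (\<lambda>x i. v x i - \<delta> * w x i) t = value_of M v t - \<delta> * value_of M w t"
      if "t \<in> Adm" for t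
    proof -
      note t = Adm_simplex_fields[OF that]
      obtain G H where G: "\<And>x i. x \<in> space M \<Longrightarrow> norm (v x i) \<le> G x" "\<And>x i. x \<in> space M \<Longrightarrow> norm (w x i) \<le> H x"
        using v w unfolding dominated_def by metis
      have "bary (t x) (\<lambda>i. v x i - \<delta> * w x i) = bary (t x) (v x) - \<delta> * bary (t x) (w x)"
        if x: "x \<in> space M" for x
      proof -
        note a = simplex_fieldsD(2)[OF t x]
        have "summable (\<lambda>i. t x i *\<^sub>R v x i)" "summable (\<lambda>i. t x i *\<^sub>R w x i)"
          by (rule simplex_seq_summable[OF a G(1)[OF x]] simplex_seq_summable[OF a G(2)[OF x]])+
        then have "(\<lambda>i. t x i *\<^sub>R v x i - \<delta> * (t x i *\<^sub>R w x i)) sums (bary (t x) (v x) - \<delta> * bary (t x) (w x))"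
          unfolding bary_def by (intro sums_diff sums_mult summable_sums)
        then show ?thesis by (simp add: bary_def sums_iff algebra_simps)
      qed
      then have "value_of M (\<lambda>x i. v x i - \<delta> * w x i) t = (LINT x|M. bary (t x) (v x) - \<delta> * bary (t x) (w x))"
        unfolding value_of_def by (intro Bochner_Integration.integral_cong) auto
      then show ?thesis
        using integrable_bary[OF t v] integrable_bary[OF t w] by (simp add: value_of_def)
    qed
    have near_w: "\<bar>value_of M w t - (LINT x|M. t x (\<iota> x))\<bar> \<le> \<kappa>" if "t \<in> Adm" for t
    proof -
      note t = Adm_simplex_fields[OF that]
      have int: "integrable M (\<lambda>x. bary (t x) (w x))" "integrable M (\<lambda>x. t x (\<iota> x))"
        using integrable_bary[OF t w] integrable_selected_coordinate[OF finite_measure_axioms t \<iota>(1)] by auto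
      \<comment> \<open>On \<open>C\<close> the function \<open>w\<close> reads off the selected
        entry exactly; elsewhere both terms lie between 0 and 1.\<close>
      have pt: "\<bar>bary (t x) (w x) - t x (\<iota> x)\<bar> \<le> indicator (space M - C) x" if x: "x \<in> space M" for x
      proof -
        note a = simplex_fieldsD(2)[OF t x]
        show ?thesis
        proof (cases "x \<in> C")
          case True
          have "bary (t x) (w x) = bary (vertex (\<iota> x)) (t x)"
            using wC True by (simp add: bary_def mult.commute)
          then show ?thesis using True by (simp add: bary_vertex)
        next
          case False
          have "bary (t x) (w x) \<le> 1"
            using norm_bary_le[OF a, of "w x" 1] w01 x by auto
          moreover have "0 \<le> bary (t x) (w x)"
          proof -
            have "summable (\<lambda>i. t x i *\<^sub>R w x i)"
              using w01 x by (intro simplex_seq_summable[OF a, where B = 1]) auto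
            then show ?thesis
              unfolding bary_def using w01 x simplex_seq_nonneg[OF a] by (intro suminf_nonneg) auto
          qed
          ultimately show ?thesis
            using False x simplex_seq_nonneg[OF a, of "\<iota> x"] simplex_seq_le_1[OF a, of "\<iota> x"] by simp
        qed
      qed
      have "\<bar>LINT x|M. bary (t x) (w x) - t x (\<iota> x)\<bar> \<le> (LINT x|M. indicator (space M - C) x)"
        using int pt
        by (intro order_trans[OF integral_abs_bound] integral_mono)
           (auto intro!: integrable_real_indicator simp: less_top[symmetric])
      then show ?thesis using int small by (simp add: value_of_def)
    qed
    define c where "c = p + 2 * \<eta> - \<delta> * (\<mu> - \<kappa>)"
    have "(LINT x|M. pure \<iota> x (\<iota> x)) = \<mu>" by (simp add: pure_def vertex_def \<mu>_def)
    then have "\<mu> - \<kappa> \<le> value_of M w (pure \<iota>)" using near_w[OF \<iota>(2)] by (simp add: abs_le_iff)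
    then have "\<delta> * (\<mu> - \<kappa>) \<le> \<delta> * value_of M w (pure \<iota>)" using \<delta> by simp
    then have "value_of M (\<lambda>x i. v x i - \<delta> * w x i) (pure \<iota>) < c"
      using sub[OF \<iota>(2)] \<iota>(3) t0(2) pos by (simp add: c_def)
    moreover have "(LINT x|M. 1 - t x (\<iota> x)) \<le> r"
      if t: "t \<in> Adm" and le: "value_of M (\<lambda>x i. v x i - \<delta> * w x i) t \<le> c" for t
    proof -
      define e where "e = (LINT x|M. 1 - t x (\<iota> x))"
      have "(LINT x|M. t x (\<iota> x)) = \<mu> - e"
        using integrable_selected_coordinate[OF finite_measure_axioms Adm_simplex_fields[OF t] \<iota>(1)]
        by (simp add: e_def \<mu>_def)
      then have "\<delta> * value_of M w t \<le> \<delta> * (\<mu> - e + \<kappa>)"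
        using near_w[OF t] \<delta> by (simp add: abs_le_iff)
      \<comment> \<open>Since \<open>t\<close> cannot beat the infimum \<open>p\<close> for
        \<open>v\<close>, a low perturbed cost is possible only through a large reward
        \<open>value_of M w t\<close>, that is, a small distance \<open>e\<close>.\<close>
      then have "\<delta> * e \<le> 2 * \<eta> + 2 * (\<delta> * \<kappa>)"
        using le sub[OF t] p_le[OF t] by (simp add: c_def algebra_simps)
      also have "\<dots> = \<delta> * r" by (simp add: \<eta>_def \<kappa>_def)
      finally show ?thesis using \<delta> by (simp add: e_def)
    qed
    ultimately show ?thesis using \<iota> unfolding concentrated_def by blast
  qed
  then show ?thesis using \<iota>(1) pos(1) by blast
qed

end

section \<open>Continuous functions with values in the absolutely summable sequences\<close>

lemma ell1_dist_nonneg: "0 \<le> ell1_dist a b"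
  by (rule Metric_space.nonneg[OF Metric_space_ell1])

lemma abs_diff_le_ell1_dist:
  assumes "a \<in> ell1" "b \<in> ell1"
  shows "\<bar>a i - b i\<bar> \<le> ell1_dist a b"
  using sum_le_suminf[OF summable_ell1_diff[OF assms], of "{i}"] assms by (simp add: ell1_dist_def)

text \<open>Replaces continuity between abstract topologies by a limit of real numbers, to which the
  usual limit rules apply. Boundedness is automatic by compactness.\<close>

lemma mspace_C_ell1_iff:
  fixes K :: "'a::metric_space set"
  assumes "compact K"
  shows "v \<in> mspace (C_ell1 K) \<longleftrightarrow> v \<in> extensional K \<and> (\<forall>x\<in>K. v x \<in> ell1) \<and>
           (\<forall>x\<in>K. ((\<lambda>y. ell1_dist (v x) (v y)) \<longlongrightarrow> 0) (at x within K))"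
proof -
  have "continuous_map (mtopology_of (submetric euclidean_metric K)) (mtopology_of ell1_metric) v \<longleftrightarrow>
      v ` K \<subseteq> ell1 \<and> (\<forall>a\<in>K. \<forall>e>0. \<exists>d>0. \<forall>x. x \<in> K \<and> dist a x < d \<longrightarrow> ell1_dist (v a) (v x) < e)"
    unfolding mtopology_of_def
    using Metric_space.metric_continuous_map[OF Metric_space_mspace_mdist[of "submetric euclidean_metric K"]
      Metric_space_mspace_mdist[of ell1_metric], of v] by simp
  then have "continuous_map (top_of_set K) (mtopology_of ell1_metric) v \<longleftrightarrow>
      v ` K \<subseteq> ell1 \<and> (\<forall>a\<in>K. \<forall>e>0. \<exists>d>0. \<forall>x. x \<in> K \<and> dist a x < d \<longrightarrow> ell1_dist (v a) (v x) < e)"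
    by (simp add: mtopology_of_submetric)
  moreover have "((\<lambda>y. ell1_dist (v x) (v y)) \<longlongrightarrow> 0) (at x within K) \<longleftrightarrow>
      (\<forall>e>0. \<exists>d>0. \<forall>y. y \<in> K \<and> dist x y < d \<longrightarrow> ell1_dist (v x) (v y) < e)"
    if "v x \<in> ell1" for x
  proof -
    have "ell1_dist (v x) (v x) = 0" using that by (simp add: ell1_dist_def)
    then show ?thesis
      unfolding tendsto_iff eventually_at
      by (simp add: dist_real_def ell1_dist_nonneg dist_commute) metis
  qed
  ultimately show ?thesis
    unfolding C_ell1_def using assms by (subst compactin_mspace_cfunspace) auto
qed

lemma continuous_on_coordinate:
  fixes K :: "'a::metric_space set"
  assumes K: "compact K" and v: "v \<in> mspace (C_ell1 K)"
  shows "continuous_on K (\<lambda>x. v x i)"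
  unfolding continuous_on_def
proof
  fix x assume x: "x \<in> K"
  have "((\<lambda>y. v y i - v x i) \<longlongrightarrow> 0) (at x within K)"
  proof (rule Lim_null_comparison)
    show "((\<lambda>y. ell1_dist (v x) (v y)) \<longlongrightarrow> 0) (at x within K)"
      using v x K by (simp add: mspace_C_ell1_iff)
    show "eventually (\<lambda>y. norm (v y i - v x i) \<le> ell1_dist (v x) (v y)) (at x within K)"
      unfolding eventually_at_filter
      using v x K abs_diff_le_ell1_dist[of "v x" _ i]
      by (auto simp: mspace_C_ell1_iff abs_minus_commute intro!: always_eventually)
  qed
  then show "((\<lambda>y. v y i) \<longlongrightarrow> v x i) (at x within K)" by (simp add: LIM_zero_iff)
qed

lemma bounded_coordinates:
  assumes v: "v \<in> mspace (C_ell1 K)"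
  shows "\<exists>B. \<forall>x\<in>K. \<forall>i. \<bar>v x i\<bar> \<le> B"
proof (cases "K = {}")
  case False
  have "Metric_space.mbounded ell1 ell1_dist (v ` K)"
    using v by (simp add: C_ell1_def)
  then obtain a B where aB: "a \<in> ell1" "\<And>x. x \<in> K \<Longrightarrow> v x \<in> ell1 \<and> ell1_dist a (v x) \<le> B"
    using False unfolding Metric_space.mbounded[OF Metric_space_ell1] by auto
  have "\<bar>v x i\<bar> \<le> (\<Sum>i. \<bar>a i\<bar>) + B" if x: "x \<in> K" for x i
  proof -
    have "\<bar>a i\<bar> \<le> (\<Sum>i. \<bar>a i\<bar>)"
      using aB x sum_le_suminf[of "\<lambda>i. \<bar>a i\<bar>" "{i}"] by (auto simp: ell1_def)
    moreover have "\<bar>a i - v x i\<bar> \<le> B"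
      using aB x abs_diff_le_ell1_dist[of a "v x" i] by force
    ultimately show ?thesis by linarith
  qed
  then show ?thesis by blast
qed simp

lemma dominated_C_ell1:
  fixes K :: "'a::euclidean_space set"
  assumes K: "compact K" and v: "v \<in> mspace (C_ell1 K)"
  shows "dominated (lebesgue_on K) (\<lambda>i x. v x i)"
proof -
  interpret finite_measure "lebesgue_on K"
    using K by (intro finite_measure_lebesgue_on lmeasurable_compact)
  obtain B where "\<forall>x\<in>K. \<forall>i. \<bar>v x i\<bar> \<le> B" using bounded_coordinates[OF v] by blast
  moreover have "K \<in> sets lebesgue" using lmeasurable_compact[OF K] by blast
  ultimately show ?thesis
    unfolding dominated_def
    by (intro conjI allI exI[of _ "\<lambda>_. B"] continuous_imp_measurable_on_sets_lebesgue
        continuous_on_coordinate[OF K v]) auto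
qed

lemma diff_in_C_ell1:
  fixes K :: "'a::metric_space set"
  assumes K: "compact K" and v: "v \<in> mspace (C_ell1 K)" and w: "w \<in> mspace (C_ell1 K)"
  shows "(\<lambda>x\<in>K. \<lambda>i. v x i - \<delta> * w x i) \<in> mspace (C_ell1 K)"
proof -
  let ?u = "\<lambda>x\<in>K. \<lambda>i. v x i - \<delta> * w x i"
  have vw: "v x \<in> ell1" "w x \<in> ell1" if "x \<in> K" for x
    using v w K that by (auto simp: mspace_C_ell1_iff)
  have u: "?u x \<in> ell1" if "x \<in> K" for x
  proof -
    have "summable (\<lambda>i. \<bar>v x i\<bar> + \<bar>\<delta>\<bar> * \<bar>w x i\<bar>)"
      using vw[OF that] by (intro summable_add summable_mult) (auto simp: ell1_def)
    moreover have "norm \<bar>v x i - \<delta> * w x i\<bar> \<le> \<bar>v x i\<bar> + \<bar>\<delta>\<bar> * \<bar>w x i\<bar>" for i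
      using abs_triangle_ineq4[of "v x i" "\<delta> * w x i"] by (simp add: abs_mult)
    ultimately have "summable (\<lambda>i. \<bar>v x i - \<delta> * w x i\<bar>)"
      by (rule summable_comparison_test')
    then show ?thesis using that by (simp add: ell1_def)
  qed
  have "((\<lambda>y. ell1_dist (?u x) (?u y)) \<longlongrightarrow> 0) (at x within K)" if x: "x \<in> K" for x
  proof (rule Lim_null_comparison)
    have "((\<lambda>y. ell1_dist (v x) (v y) + \<bar>\<delta>\<bar> * ell1_dist (w x) (w y)) \<longlongrightarrow> 0 + \<bar>\<delta>\<bar> * 0) (at x within K)"
      using v w K x by (intro tendsto_intros) (auto simp: mspace_C_ell1_iff)
    then show "((\<lambda>y. ell1_dist (v x) (v y) + \<bar>\<delta>\<bar> * ell1_dist (w x) (w y)) \<longlongrightarrow> 0) (at x within K)"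
      by simp
    have "ell1_dist (?u x) (?u y) \<le> ell1_dist (v x) (v y) + \<bar>\<delta>\<bar> * ell1_dist (w x) (w y)" if y: "y \<in> K" for y
    proof -
      note s = summable_ell1_diff[OF vw(1)[OF x] vw(1)[OF y]] summable_ell1_diff[OF vw(2)[OF x] vw(2)[OF y]]
      have "ell1_dist (?u x) (?u y) = (\<Sum>i. \<bar>?u x i - ?u y i\<bar>)"
        using u[OF x] u[OF y] by (simp only: ell1_dist_def if_True simp_thms)
      also have "\<dots> \<le> (\<Sum>i. \<bar>v x i - v y i\<bar> + \<bar>\<delta>\<bar> * \<bar>w x i - w y i\<bar>)"
      proof (intro suminf_le summable_ell1_diff[OF u[OF x] u[OF y]] summable_add s summable_mult)
        show "\<bar>?u x i - ?u y i\<bar> \<le> \<bar>v x i - v y i\<bar> + \<bar>\<delta>\<bar> * \<bar>w x i - w y i\<bar>" for i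
        proof -
          have "?u x i - ?u y i = (v x i - v y i) - \<delta> * (w x i - w y i)"
            using x y by (simp add: algebra_simps)
          then show ?thesis by (metis abs_mult abs_triangle_ineq4)
        qed
      qed
      also have "\<dots> = ell1_dist (v x) (v y) + \<bar>\<delta>\<bar> * ell1_dist (w x) (w y)"
        using s vw[OF x] vw[OF y] by (simp add: ell1_dist_def suminf_add[symmetric] suminf_mult summable_mult)
      finally show ?thesis .
    qed
    then show "eventually (\<lambda>y. norm (ell1_dist (?u x) (?u y))
        \<le> ell1_dist (v x) (v y) + \<bar>\<delta>\<bar> * ell1_dist (w x) (w y)) (at x within K)"
      unfolding eventually_at_filter by (intro always_eventually) (auto simp: ell1_dist_nonneg)
  qed
  then show ?thesis using K u by (simp add: mspace_C_ell1_iff)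
qed

text \<open>With a common finite support the l1 distance is a finite sum, so coordinatewise
  continuity suffices.\<close>

lemma finitely_many_coordinates_in_C_ell1:
  fixes K :: "'a::metric_space set"
  assumes K: "compact K" and cont: "\<And>i. continuous_on K (\<lambda>x. u x i)" and fin: "\<And>x i. i \<ge> N \<Longrightarrow> u x i = 0"
  shows "restrict u K \<in> mspace (C_ell1 K)"
proof -
  have u: "u x \<in> ell1" for x
    unfolding ell1_def using fin by (auto intro!: summable_finite[of "{..<N}"]) (meson not_le)
  have dist: "ell1_dist (u x) (u y) = (\<Sum>i<N. \<bar>u x i - u y i\<bar>)" for x y
    using u fin by (auto simp: ell1_dist_def intro!: suminf_finite) (metis diff_zero not_le)
  have "((\<lambda>y. ell1_dist (u x) (u y)) \<longlongrightarrow> (\<Sum>i<N. \<bar>u x i - u x i\<bar>)) (at x within K)" if "x \<in> K" for x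
    unfolding dist using cont that by (intro tendsto_intros) (auto simp: continuous_on_def)
  then have "((\<lambda>y. ell1_dist (u x) (restrict u K y)) \<longlongrightarrow> 0) (at x within K)" if "x \<in> K" for x
    using that by (subst Lim_cong_within[OF refl refl refl]) auto
  then show ?thesis using K u by (simp add: mspace_C_ell1_iff)
qed

text \<open>
  Lusin-type approximation: inner regularity on finitely many level sets, Urysohn functions for the
  disjoint closed sets so obtained, and normalization to keep the \<open>\<ell>\<^sup>1\<close> norm below \<open>1\<close>.
\<close>

lemma approximate_pure_by_C_ell1:
  fixes K :: "'a::euclidean_space set"
  assumes K: "compact K" and \<iota>[measurable]: "\<iota> \<in> measurable (lebesgue_on K) (count_space UNIV)" and \<kappa>: "0 < \<kappa>"
  shows "\<exists>w\<in>mspace (C_ell1 K). \<exists>C\<in>sets (lebesgue_on K). measure (lebesgue_on K) (K - C) \<le> \<kappa> \<and>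
           (\<forall>x\<in>K. \<forall>i. 0 \<le> w x i) \<and> (\<forall>x\<in>K. (\<Sum>i. \<bar>w x i\<bar>) \<le> 1) \<and> (\<forall>x\<in>C. w x = vertex (\<iota> x))"
proof -
  let ?M = "lebesgue_on K"
  interpret finite_measure ?M
    using K by (intro finite_measure_lebesgue_on lmeasurable_compact)
  have Kl: "K \<in> sets lebesgue" using lmeasurable_compact[OF K] by blast
  define B where "B n = {x \<in> space ?M. n \<le> \<iota> x}" for n
  have B[measurable]: "B n \<in> sets ?M" for n unfolding B_def by measurable
  \<comment> \<open>The tails decrease to the empty set, so all but \<open>\<kappa> / 2\<close> of
    \<open>K\<close> lies in finitely many level sets.\<close>
  have "(\<lambda>n. measure ?M (B n)) \<longlonglongrightarrow> measure ?M (\<Inter>n. B n)"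
    using B by (intro finite_Lim_measure_decseq) (auto simp: decseq_def B_def)
  also have "(\<Inter>n. B n) = {}" by (auto simp: B_def) (metis not_less_eq_eq)
  finally have "eventually (\<lambda>n. measure ?M (B n) < \<kappa> / 2) sequentially"
    using \<kappa> by (intro order_tendstoD(2)) auto
  then obtain N where N: "measure ?M (B N) < \<kappa> / 2" by (meson eventually_sequentially order_refl)
  define A where "A i = {x \<in> space ?M. \<iota> x = i}" for i
  have A[measurable]: "A i \<in> sets ?M" for i unfolding A_def by measurable
  have Al: "A i \<in> sets lebesgue" for i using A[of i] Kl by (auto simp: sets_restrict_space_iff)
  \<comment> \<open>The \<open>N\<close> level sets together lose at most the other
    \<open>\<kappa> / 2\<close>; \<open>Suc N\<close> avoids division by 0.\<close>
  define \<epsilon> where "\<epsilon> = \<kappa> / (2 * real (Suc N))"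
  have \<epsilon>: "\<epsilon> > 0" using \<kappa> by (simp add: \<epsilon>_def)
  have "\<exists>T. closed T \<and> T \<subseteq> A i \<and> emeasure lebesgue (A i - T) < ennreal \<epsilon>" for i
    using sets_lebesgue_inner_closed[OF Al \<epsilon>, of i] by metis
  then obtain T where T: "\<And>i. closed (T i)" "\<And>i. T i \<subseteq> A i"
    and T_small: "\<And>i. emeasure lebesgue (A i - T i) < ennreal \<epsilon>" by metis
  have TK: "T i \<subseteq> K" for i using T(2)[of i] by (auto simp: A_def)
  have T_sets[measurable]: "T i \<in> sets ?M" for i
    using T(1)[of i] TK Kl by (auto simp: sets_restrict_space_iff borel_closed)
  define C where "C = (\<Union>i<N. T i)"
  have C[measurable]: "C \<in> sets ?M" unfolding C_def by measurable
  have small: "measure ?M (K - C) \<le> \<kappa>"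
  proof -
    have "measure ?M (A i - T i) \<le> \<epsilon>" for i
    proof -
      have "emeasure ?M (A i - T i) = emeasure lebesgue (A i - T i)"
        using Kl by (intro emeasure_restrict_space) (auto simp: A_def)
      then have "emeasure ?M (A i - T i) \<le> ennreal \<epsilon>" using T_small[of i] by simp
      then show ?thesis using \<epsilon> by (simp add: emeasure_eq_measure)
    qed
    then have 1: "(\<Sum>i<N. measure ?M (A i - T i)) \<le> real N * \<epsilon>"
      using sum_mono[of "{..<N}" "\<lambda>i. measure ?M (A i - T i)" "\<lambda>_. \<epsilon>"] by simp
    also have "\<dots> \<le> \<kappa> / 2" using \<kappa> by (simp add: \<epsilon>_def field_simps)
    finally have 2: "measure ?M (\<Union>i<N. A i - T i) \<le> \<kappa> / 2"
      by (intro order_trans[OF finite_measure_subadditive_finite]) auto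
    have "K - C \<subseteq> B N \<union> (\<Union>i<N. A i - T i)" by (auto simp: B_def A_def C_def)
    then have "measure ?M (K - C) \<le> measure ?M (B N \<union> (\<Union>i<N. A i - T i))"
      by (intro finite_measure_mono) measurable
    also have "\<dots> \<le> measure ?M (B N) + measure ?M (\<Union>i<N. A i - T i)"
      by (intro measure_Un_le) measurable
    finally show ?thesis using N 2 by simp
  qed
  define P where "P i \<phi> \<longleftrightarrow> continuous_on UNIV \<phi> \<and> (\<forall>x. 0 \<le> \<phi> x) \<and> (\<forall>x\<in>T i. \<phi> x = 1) \<and>
      (\<forall>x\<in>(\<Union>j\<in>{..<N} - {i}. T j). \<phi> x = 0)" for i and \<phi> :: "'a \<Rightarrow> real"
  have "\<exists>\<phi>. P i \<phi>" for i
  proof -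
    have "closed (\<Union>j\<in>{..<N} - {i}. T j)" using T by (intro closed_UN) auto
    moreover have "T i \<inter> T j = {}" if "j \<noteq> i" for j
      using T(2)[of i] T(2)[of j] that by (auto simp: A_def)
    then have "T i \<inter> (\<Union>j\<in>{..<N} - {i}. T j) = {}" by blast
    ultimately obtain \<phi> :: "'a \<Rightarrow> real" where "continuous_on UNIV \<phi>" "\<And>x. \<phi> x \<in> closed_segment 1 0"
      "\<And>x. x \<in> T i \<Longrightarrow> \<phi> x = 1" "\<And>x. x \<in> (\<Union>j\<in>{..<N} - {i}. T j) \<Longrightarrow> \<phi> x = 0"
      using Urysohn[OF T(1)[of i], of "\<Union>j\<in>{..<N} - {i}. T j" 1 0] by metis
    then show ?thesis by (intro exI[of _ \<phi>]) (auto simp: P_def closed_segment_eq_real_ivl)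
  qed
  then obtain \<phi> where P: "\<And>i. P i (\<phi> i)" by metis
  have \<phi>: "continuous_on UNIV (\<phi> i)" "0 \<le> \<phi> i x" "x \<in> T i \<Longrightarrow> \<phi> i x = 1"
    "j < N \<Longrightarrow> j \<noteq> i \<Longrightarrow> x \<in> T j \<Longrightarrow> \<phi> i x = 0" for i j x
    using P[of i] by (auto simp: P_def)
  \<comment> \<open>The maximum with 1 keeps the quotient continuous and the l1 norm at most 1. On
    \<open>C\<close> exactly one summand is nonzero and equals 1, so the normalization changes
    nothing there.\<close>
  define \<Phi> where "\<Phi> x = max 1 (\<Sum>i<N. \<phi> i x)" for x
  have \<Phi>: "1 \<le> \<Phi> x" for x by (simp add: \<Phi>_def)
  define u where "u x i = (if i < N then \<phi> i x / \<Phi> x else 0)" for x i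
  have u_nonneg: "0 \<le> u x i" for x i using \<phi>(2)[of i x] \<Phi>[of x] by (simp add: u_def)
  have "continuous_on K (\<lambda>x. u x i)" for i
  proof -
    have [continuous_intros]: "continuous_on K (\<phi> i)" for i
      using \<phi>(1) continuous_on_subset by blast
    have "continuous_on K (\<lambda>x. \<phi> i x / \<Phi> x)"
    proof (intro continuous_on_divide ballI)
      show "continuous_on K \<Phi>" unfolding \<Phi>_def by (intro continuous_intros)
      show "\<Phi> x \<noteq> 0" for x using \<Phi>[of x] by linarith
    qed (rule continuous_intros)
    then show ?thesis by (cases "i < N") (simp_all add: u_def)
  qed
  then have mem: "restrict u K \<in> mspace (C_ell1 K)"
    by (rule finitely_many_coordinates_in_C_ell1[OF K, of _ N]) (simp add: u_def)
  have "(\<Sum>i. \<bar>u x i\<bar>) \<le> 1" for x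
  proof -
    have "(\<Sum>i. \<bar>u x i\<bar>) = (\<Sum>i<N. \<bar>u x i\<bar>)" by (rule suminf_finite) (auto simp: u_def)
    also have "\<dots> = (\<Sum>i<N. \<phi> i x) / \<Phi> x"
      unfolding abs_of_nonneg[OF u_nonneg] by (simp add: u_def sum_divide_distrib)
    also have "\<dots> \<le> 1" using \<Phi>[of x] by (simp add: \<Phi>_def)
    finally show ?thesis .
  qed
  moreover have "u x = vertex (\<iota> x)" if x: "x \<in> C" for x
  proof -
    obtain j where j: "j < N" "x \<in> T j" using x by (auto simp: C_def)
    then have "\<iota> x = j" using T(2)[of j] by (auto simp: A_def)
    have "(\<Sum>i<N. \<phi> i x) = (\<Sum>i\<in>{j}. \<phi> i x)"
      using j \<phi>(4)[OF j(1) _ j(2)] by (intro sum.mono_neutral_right) auto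
    then have "\<Phi> x = 1" using \<phi>(3)[OF j(2)] by (simp add: \<Phi>_def)
    then show ?thesis
      using j \<phi>(3)[OF j(2)] \<phi>(4)[OF j(1) _ j(2)] \<open>\<iota> x = j\<close> by (auto simp: u_def vertex_def)
  qed
  moreover have "C \<subseteq> K" using TK by (auto simp: C_def)
  ultimately show ?thesis
    using mem C small u_nonneg by (intro bexI[of _ "restrict u K"] bexI[of _ C]) auto
qed

section \<open>Fields with values in the bounded sequences\<close>

lemma apply_Bcontfun_simplex_seq:
  assumes a: "a \<in> simplex_seq"
  shows "apply_bcontfun (Bcontfun a) = a"
proof (rule Bcontfun_inverse)
  show "a \<in> bcontfun"
    using simplex_seq_nonneg[OF a] simplex_seq_le_1[OF a] by (intro bcontfun_normI[where b = 1]) auto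
qed

lemma borel_measurable_apply_bcontfun:
  assumes [measurable]: "\<theta> \<in> borel_measurable M"
  shows "(\<lambda>x. apply_bcontfun (\<theta> x) i) \<in> borel_measurable M"
proof -
  have "continuous_on UNIV (\<lambda>b :: 'b \<Rightarrow>\<^sub>C 'c. apply_bcontfun b i)"
    unfolding continuous_on_iff by (meson dist_bounded le_less_trans)
  then have [measurable]: "(\<lambda>b :: 'b \<Rightarrow>\<^sub>C 'c. apply_bcontfun b i) \<in> borel_measurable borel"
    by (rule borel_measurable_continuous_onI)
  show ?thesis by measurable
qed

text \<open>
  \<open>nat \<Rightarrow>\<^sub>C real\<close> is not separable, but elements of the simplex tend to zero, so that
  the finitely supported rational sequences are dense near the range of the field.
\<close>

lemma borel_measurable_Bcontfun:
  assumes t: "t \<in> simplex_fields M"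
  shows "(\<lambda>x. Bcontfun (t x)) \<in> borel_measurable M"
proof (rule borel_measurableI)
  fix U :: "(nat \<Rightarrow>\<^sub>C real) set" assume U: "open U"
  have [measurable]: "(\<lambda>x. t x i) \<in> borel_measurable M" for i by (rule simplex_fieldsD(1)[OF t])
  define q :: "rat list \<Rightarrow> nat \<Rightarrow> real" where "q l i = (if i < length l then of_rat (l ! i) else 0)" for l i
  define d where "d l = Bcontfun (q l)" for l
  have d: "apply_bcontfun (d l) = q l" for l
    unfolding d_def
  proof (rule Bcontfun_inverse)
    have "range (q l) \<subseteq> insert 0 (of_rat ` set l)" by (auto simp: q_def)
    then have "finite (range (q l))" by (rule finite_subset) simp
    then have "bounded (range (q l))" by (rule finite_imp_bounded)
    then show "q l \<in> bcontfun" by (simp add: bcontfun_def)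
  qed
  define S where "S l n = {x \<in> space M. \<forall>i. \<bar>q l i - t x i\<bar> \<le> 1 / real (Suc n)}" for l n
  \<comment> \<open>Pairs of a rational list and a natural number are countable, so the preimage of
    \<open>U\<close> becomes a countable union of the measurable sets \<open>S l n\<close>.\<close>
  define I where "I = {(l, n). cball (d l) (1 / real (Suc n)) \<subseteq> U}"
  have "(\<lambda>x. Bcontfun (t x)) -` U \<inter> space M = (\<Union>(l, n)\<in>I. S l n)"
  proof (intro equalityI subsetI)
    fix x assume "x \<in> (\<Union>(l, n)\<in>I. S l n)"
    then obtain l n where ln: "cball (d l) (1 / real (Suc n)) \<subseteq> U" "x \<in> space M"
      "\<And>i. \<bar>q l i - t x i\<bar> \<le> 1 / real (Suc n)" by (auto simp: S_def I_def)
    have "dist (d l) (Bcontfun (t x)) \<le> 1 / real (Suc n)"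
      using ln(3) by (intro dist_bound)
        (simp add: d apply_Bcontfun_simplex_seq[OF simplex_fieldsD(2)[OF t ln(2)]] dist_real_def)
    then show "x \<in> (\<lambda>x. Bcontfun (t x)) -` U \<inter> space M" using ln by auto
  next
    fix x assume "x \<in> (\<lambda>x. Bcontfun (t x)) -` U \<inter> space M"
    then have x: "x \<in> space M" "Bcontfun (t x) \<in> U" by auto
    note a = simplex_fieldsD(2)[OF t x(1)]
    obtain e where e: "e > 0" "ball (Bcontfun (t x)) e \<subseteq> U" using U x(2) openE by blast
    \<comment> \<open>Half of \<open>e\<close>, because the closed ball around the approximating
      sequence must stay in the ball around the value itself.\<close>
    obtain n where n: "1 / real (Suc n) < e / 2" using nat_approx_posE[of "e / 2"] e by auto
    let ?r = "1 / real (Suc n)"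
    have "(\<lambda>i. t x i) \<longlonglongrightarrow> 0"
      using a by (intro summable_LIMSEQ_zero) (auto simp: simplex_seq_def sums_iff)
    then have "eventually (\<lambda>i. t x i < ?r) sequentially" by (rule order_tendstoD(2)) simp
    then obtain N where N: "\<And>i. i \<ge> N \<Longrightarrow> t x i < ?r" by (auto simp: eventually_sequentially)
    have "\<exists>r. \<bar>of_rat r - t x i\<bar> \<le> ?r" for i
    proof -
      obtain r where "t x i < of_rat r" "of_rat r < t x i + ?r"
        using of_rat_dense[of "t x i" "t x i + ?r"] by auto
      then show ?thesis by (intro exI[of _ r]) simp
    qed
    then obtain r where r: "\<And>i. \<bar>of_rat (r i) - t x i\<bar> \<le> ?r" by metis
    define l where "l = map r [0..<N]"
    have close: "\<bar>q l i - t x i\<bar> \<le> ?r" for i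
      using r[of i] N[of i] simplex_seq_nonneg[OF a, of i] by (cases "i < N") (auto simp: q_def l_def)
    have "dist (d l) (Bcontfun (t x)) \<le> ?r"
      using close by (intro dist_bound) (simp add: d apply_Bcontfun_simplex_seq[OF a] dist_real_def)
    have "cball (d l) ?r \<subseteq> U"
    proof
      fix z assume "z \<in> cball (d l) ?r"
      then have "dist (Bcontfun (t x)) z \<le> ?r + ?r"
        using \<open>dist (d l) (Bcontfun (t x)) \<le> ?r\<close> dist_triangle3[of "Bcontfun (t x)" z "d l"] by simp
      then show "z \<in> U" using n e by (intro subsetD[OF e(2)]) simp
    qed
    then show "x \<in> (\<Union>(l, n)\<in>I. S l n)" using close x(1) by (auto simp: I_def S_def)
  qed
  moreover have "S l n \<in> sets M" for l n unfolding S_def by measurable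
  ultimately show "(\<lambda>x. Bcontfun (t x)) -` U \<inter> space M \<in> sets M"
    by (auto intro!: sets.countable_UN' simp: case_prod_beta)
qed

lemma Bcontfun_in_Linf_ellinf:
  assumes t: "t \<in> simplex_fields (lebesgue_on K)"
  shows "(\<lambda>x. Bcontfun (t x)) \<in> Linf_ellinf K"
proof -
  have "norm (Bcontfun (t x)) \<le> 1" if "x \<in> space (lebesgue_on K)" for x
    using simplex_fieldsD(2)[OF t that] simplex_seq_nonneg simplex_seq_le_1
    by (intro norm_bound) (auto simp: apply_Bcontfun_simplex_seq)
  then show ?thesis
    using borel_measurable_Bcontfun[OF t] unfolding Linf_ellinf_def
    by (intro CollectI conjI exI[of _ 1] AE_I2)
qed

section \<open>Passage between almost everywhere conditions and fields in the simplex\<close>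

lemma simplex_field_of_AE:
  assumes \<theta>[measurable]: "\<theta> \<in> borel_measurable M"
    and AE: "AE x in M. (\<forall>i. 0 \<le> apply_bcontfun (\<theta> x) i) \<and> (\<lambda>i. apply_bcontfun (\<theta> x) i) sums (1::real)"
  shows "\<exists>t\<in>simplex_fields M. AE x in M. apply_bcontfun (\<theta> x) = t x"
proof -
  have [measurable]: "(\<lambda>x. apply_bcontfun (\<theta> x) i) \<in> borel_measurable M" for i
    by (rule borel_measurable_apply_bcontfun[OF \<theta>])
  \<comment> \<open>Summing in \<open>ennreal\<close> gives a measurable condition without a
    separate question of convergence.\<close>
  define P where "P x \<longleftrightarrow> (\<forall>i. 0 \<le> apply_bcontfun (\<theta> x) i) \<and> (\<Sum>i. ennreal (apply_bcontfun (\<theta> x) i)) = 1" for x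
  have [measurable]: "Measurable.pred M P" unfolding P_def by measurable
  have P: "P x \<longleftrightarrow> apply_bcontfun (\<theta> x) \<in> simplex_seq" for x
  proof (cases "\<forall>i. 0 \<le> apply_bcontfun (\<theta> x) i")
    case True
    then have "(\<Sum>i. ennreal (apply_bcontfun (\<theta> x) i)) = ennreal 1 \<longleftrightarrow> apply_bcontfun (\<theta> x) sums 1"
      by (subst sums_ennreal[symmetric]) (auto simp: sums_iff)
    then show ?thesis using True by (simp add: P_def simplex_seq_def)
  qed (auto simp: P_def simplex_seq_def)
  define t where "t x = (if P x then apply_bcontfun (\<theta> x) else vertex 0)" for x
  have "(\<lambda>x. t x i) \<in> borel_measurable M" for i
  proof -
    have "(\<lambda>x. if P x then apply_bcontfun (\<theta> x) i else vertex 0 i) \<in> borel_measurable M" by measurable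
    then show ?thesis by (simp add: t_def if_distribR cong: if_cong)
  qed
  moreover have "t x \<in> simplex_seq" for x
    using P[of x] vertex_in_simplex_seq[of 0] by (simp add: t_def)
  ultimately have "t \<in> simplex_fields M"
    unfolding simplex_fields_def by blast
  moreover have "AE x in M. apply_bcontfun (\<theta> x) = t x"
    using AE by eventually_elim (auto simp: t_def P simplex_seq_def)
  ultimately show ?thesis by blast
qed

lemma integral_eq_bary:
  fixes g :: "nat \<Rightarrow> 'a \<Rightarrow> 'b::{banach, second_countable_topology}"
  assumes \<theta>: "\<theta> \<in> borel_measurable M" and t: "t \<in> simplex_fields M"
    and AE: "AE x in M. apply_bcontfun (\<theta> x) = t x" and g: "dominated M g"
  shows "(LINT x|M. (\<Sum>i. apply_bcontfun (\<theta> x) i *\<^sub>R g i x)) = (LINT x|M. bary (t x) (\<lambda>i. g i x))"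
proof (rule integral_cong_AE)
  have [measurable]: "(\<lambda>x. apply_bcontfun (\<theta> x) i) \<in> borel_measurable M" "g i \<in> borel_measurable M" for i
    using borel_measurable_apply_bcontfun[OF \<theta>] g by (auto simp: dominated_def)
  show "(\<lambda>x. \<Sum>i. apply_bcontfun (\<theta> x) i *\<^sub>R g i x) \<in> borel_measurable M" by measurable
  show "(\<lambda>x. bary (t x) (\<lambda>i. g i x)) \<in> borel_measurable M" using integrable_bary[OF t g] by simp
  show "AE x in M. (\<Sum>i. apply_bcontfun (\<theta> x) i *\<^sub>R g i x) = bary (t x) (\<lambda>i. g i x)"
    using AE by eventually_elim (simp add: bary_def)
qed

lemma admissible_imp_feasible:
  assumes f: "dominated (lebesgue_on K) f" and \<theta>: "\<theta> \<in> admissible K f \<alpha>"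
  shows "\<exists>t\<in>feasible (lebesgue_on K) f \<alpha>. AE x in lebesgue_on K. apply_bcontfun (\<theta> x) = t x"
proof -
  have m: "\<theta> \<in> borel_measurable (lebesgue_on K)"
    using \<theta> by (simp add: admissible_def Linf_ellinf_def)
  obtain t where "t \<in> simplex_fields (lebesgue_on K)" "AE x in lebesgue_on K. apply_bcontfun (\<theta> x) = t x"
    using simplex_field_of_AE[OF m] \<theta> by (auto simp: admissible_def)
  then show ?thesis
    using integral_eq_bary[OF m _ _ f] \<theta> by (auto simp: feasible_def admissible_def)
qed

lemma feasible_imp_admissible:
  assumes f: "dominated (lebesgue_on K) f" and t: "t \<in> feasible (lebesgue_on K) f \<alpha>"
  shows "(\<lambda>x. Bcontfun (t x)) \<in> admissible K f \<alpha>"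
proof -
  have t': "t \<in> simplex_fields (lebesgue_on K)" using t by (simp add: feasible_def)
  note s = simplex_fieldsD(2)[OF t']
  have "(LINT x|lebesgue_on K. (\<Sum>i. apply_bcontfun (Bcontfun (t x)) i *\<^sub>R f i x)) = \<alpha>"
    using integral_eq_bary[OF borel_measurable_Bcontfun[OF t'] t' AE_I2[OF apply_Bcontfun_simplex_seq[OF s]] f] t
    by (simp add: feasible_def)
  moreover have "AE x in lebesgue_on K. (\<forall>i. 0 \<le> apply_bcontfun (Bcontfun (t x)) i) \<and>
      (\<lambda>i. apply_bcontfun (Bcontfun (t x)) i) sums 1"
    using s by (intro AE_I2) (auto simp: apply_Bcontfun_simplex_seq simplex_seq_def)
  ultimately show ?thesis
    using Bcontfun_in_Linf_ellinf[OF t'] by (simp add: admissible_def)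
qed

lemma cost_eq_value_of:
  assumes "\<theta> \<in> Linf_ellinf K" "t \<in> simplex_fields (lebesgue_on K)"
    and "AE x in lebesgue_on K. apply_bcontfun (\<theta> x) = t x" "dominated (lebesgue_on K) (\<lambda>i x. v x i)"
  shows "cost K v \<theta> = value_of (lebesgue_on K) v t"
  using integral_eq_bary[of \<theta> "lebesgue_on K" t "\<lambda>i x. v x i"] assms
  by (simp add: cost_def value_of_def Linf_ellinf_def)

lemma cost_Bcontfun:
  assumes t: "t \<in> simplex_fields (lebesgue_on K)" and v: "dominated (lebesgue_on K) (\<lambda>i x. v x i)"
  shows "cost K v (\<lambda>x. Bcontfun (t x)) = value_of (lebesgue_on K) v t"
  using simplex_fieldsD(2)[OF t]
  by (intro cost_eq_value_of Bcontfun_in_Linf_ellinf t v) (auto simp: apply_Bcontfun_simplex_seq)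

lemma Linf_ellinf_of_admissible: "\<theta> \<in> admissible K f \<alpha> \<Longrightarrow> \<theta> \<in> Linf_ellinf K"
  by (simp add: admissible_def)

lemma relaxed_problem_lebesgue_on:
  fixes K :: "'a::euclidean_space set" and f :: "nat \<Rightarrow> 'a \<Rightarrow> 'b::euclidean_space"
  assumes K: "compact K" and "dominated (lebesgue_on K) f" "feasible (lebesgue_on K) f \<alpha> \<noteq> {}"
  shows "relaxed_problem (lebesgue_on K) f \<alpha>"
proof -
  interpret finite_measure "lebesgue_on K"
    using K by (intro finite_measure_lebesgue_on lmeasurable_compact)
  show ?thesis using assms nonatomic_lebesgue_on[OF lmeasurable_compact[OF K]] by unfold_locales
qed

section \<open>Generic uniqueness and the bang-bang property\<close>

lemma unique_solvable_of_concentrated: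
  fixes K :: "'a::euclidean_space set" and f :: "nat \<Rightarrow> 'a \<Rightarrow> 'b::euclidean_space"
  assumes K: "compact K" and f: "dominated (lebesgue_on K) f" and ne: "feasible (lebesgue_on K) f \<alpha> \<noteq> {}"
    and v: "v \<in> mspace (C_ell1 K)" and conc: "\<And>k::nat. concentrated (lebesgue_on K) f \<alpha> ((1/2) ^ k) v"
  shows "v \<in> unique_solvable K f \<alpha>"
proof -
  let ?M = "lebesgue_on K"
  interpret relaxed_problem ?M f \<alpha> by (rule relaxed_problem_lebesgue_on[OF K f ne])
  note dv = dominated_C_ell1[OF K v]
  obtain \<iota> where \<iota>: "pure \<iota> \<in> Adm" "\<And>t. t \<in> Adm \<Longrightarrow> value_of ?M v (pure \<iota>) \<le> value_of ?M v t"
    "\<And>t. t \<in> Adm \<Longrightarrow> value_of ?M v t \<le> value_of ?M v (pure \<iota>) \<Longrightarrow> AE x in ?M. t x = pure \<iota> x"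
    using unique_minimizer_of_concentrated[OF dv conc] by blast
  define \<theta> where "\<theta> x = Bcontfun (pure \<iota> x)" for x
  have \<theta>: "\<theta> \<in> admissible K f \<alpha>" unfolding \<theta>_def by (rule feasible_imp_admissible[OF f \<iota>(1)])
  have cost_\<theta>: "cost K v \<theta> = value_of ?M v (pure \<iota>)"
    unfolding \<theta>_def by (rule cost_Bcontfun[OF Adm_simplex_fields[OF \<iota>(1)] dv])
  have le: "cost K v \<theta> \<le> cost K v \<theta>'" and uniq: "cost K v \<theta>' \<le> cost K v \<theta> \<Longrightarrow> AE x in ?M. \<theta>' x = \<theta> x"
    if \<theta>': "\<theta>' \<in> admissible K f \<alpha>" for \<theta>'
  proof -
    obtain t where t: "t \<in> Adm" "AE x in ?M. apply_bcontfun (\<theta>' x) = t x"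
      using admissible_imp_feasible[OF f \<theta>'] by blast
    have c: "cost K v \<theta>' = value_of ?M v t"
      by (rule cost_eq_value_of[OF Linf_ellinf_of_admissible[OF \<theta>'] Adm_simplex_fields[OF t(1)] t(2) dv])
    show "cost K v \<theta> \<le> cost K v \<theta>'" using \<iota>(2)[OF t(1)] by (simp add: c cost_\<theta>)
    assume "cost K v \<theta>' \<le> cost K v \<theta>"
    then have "AE x in ?M. t x = pure \<iota> x" using \<iota>(3)[OF t(1)] by (simp add: c cost_\<theta>)
    then show "AE x in ?M. \<theta>' x = \<theta> x"
      using t(2)
    proof eventually_elim
      case (elim x)
      then show ?case
        unfolding \<theta>_def by (intro bcontfun_eqI) (simp add: pure_def apply_Bcontfun_simplex_seq vertex_in_simplex_seq)
    qed
  qed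
  then show ?thesis
    using v \<theta> by (auto simp: unique_solvable_def minimizers_def intro!: bexI[of _ \<theta>])
qed

lemma residual_unique_solvable:
  fixes K :: "'a::euclidean_space set" and f :: "nat \<Rightarrow> 'a \<Rightarrow> 'b::euclidean_space"
  assumes K: "compact K" and f: "dominated (lebesgue_on K) f" and ne: "feasible (lebesgue_on K) f \<alpha> \<noteq> {}"
  shows "residual_in (mtopology_of (C_ell1 K)) (unique_solvable K f \<alpha>)"
proof -
  let ?M = "lebesgue_on K" and ?C = "mspace (C_ell1 K)" and ?d = "mdist (C_ell1 K)"
  interpret relaxed_problem ?M f \<alpha> by (rule relaxed_problem_lebesgue_on[OF K f ne])
  interpret C: Metric_space ?C ?d by (rule Metric_space_mspace_mdist)
  define U where "U k = {v \<in> ?C. concentrated ?M f \<alpha> ((1/2) ^ k) v}" for k :: nat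
  have ell1: "v x \<in> ell1" if "v \<in> ?C" "x \<in> K" for v x
    using that K by (simp add: mspace_C_ell1_iff)
  have "openin C.mtopology (U k)" for k
    unfolding C.openin_mtopology
  proof (intro conjI allI impI)
    show "U k \<subseteq> ?C" by (auto simp: U_def)
    fix v assume v: "v \<in> U k"
    then have vC: "v \<in> ?C" by (simp add: U_def)
    obtain e where e: "e > 0" and *: "\<And>v'. dominated ?M (\<lambda>i x. v' x i) \<Longrightarrow>
        (\<forall>x\<in>space ?M. \<forall>i. \<bar>v x i - v' x i\<bar> \<le> e) \<Longrightarrow> concentrated ?M f \<alpha> ((1/2) ^ k) v'"
      using concentrated_open[OF dominated_C_ell1[OF K vC]] v unfolding U_def by blast
    have "C.mball v e \<subseteq> U k"
    proof
      fix v' assume "v' \<in> C.mball v e"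
      then have v': "v' \<in> ?C" "?d v v' \<le> e" by auto
      have "ell1_dist (v x) (v' x) \<le> e" if "x \<in> K" for x
        using mdist_cfunspace_imp_mdist_le[of v "top_of_set K" ell1_metric v' e x] v' vC that
        by (simp add: C_ell1_def)
      then have "\<bar>v x i - v' x i\<bar> \<le> e" if "x \<in> K" for x i
        using abs_diff_le_ell1_dist[OF ell1[OF vC that] ell1[OF v'(1) that], of i] that
        by (meson order_trans)
      then show "v' \<in> U k" using *[OF dominated_C_ell1[OF K v'(1)]] v' by (simp add: U_def)
    qed
    then show "\<exists>r>0. C.mball v r \<subseteq> U k" using e by blast
  qed
  moreover have "C.mtopology closure_of (U k) = ?C" for k
  proof -
    have "\<exists>v'\<in>U k. v' \<in> C.mcball v \<delta>" if v: "v \<in> ?C" and \<delta>: "\<delta> > 0" for v \<delta>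
    proof -
      obtain \<iota> \<kappa> where \<iota>: "\<iota> \<in> measurable ?M (count_space UNIV)" "\<kappa> > 0"
        and *: "\<And>w C. dominated ?M (\<lambda>i x. w x i) \<Longrightarrow> C \<in> sets ?M \<Longrightarrow>
           measure ?M (space ?M - C) \<le> \<kappa> \<Longrightarrow> \<forall>x\<in>space ?M. \<forall>i. 0 \<le> w x i \<and> w x i \<le> 1 \<Longrightarrow>
           \<forall>x\<in>C. w x = vertex (\<iota> x) \<Longrightarrow> concentrated ?M f \<alpha> ((1/2) ^ k) (\<lambda>x i. v x i - \<delta> * w x i)"
        using concentrated_dense[OF dominated_C_ell1[OF K v] \<delta>, of "(1/2) ^ k"] by auto
      obtain w C where w: "w \<in> ?C" and C: "C \<in> sets ?M" "measure ?M (K - C) \<le> \<kappa>"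
        and w_nonneg: "\<forall>x\<in>K. \<forall>i. 0 \<le> w x i" and w_sum: "\<forall>x\<in>K. (\<Sum>i. \<bar>w x i\<bar>) \<le> 1"
        and wC: "\<forall>x\<in>C. w x = vertex (\<iota> x)"
        using approximate_pure_by_C_ell1[OF K \<iota>] by blast
      have "w x i \<le> 1" if "x \<in> K" for x i
      proof -
        have "\<bar>w x i\<bar> \<le> (\<Sum>i. \<bar>w x i\<bar>)"
          using sum_le_suminf[of "\<lambda>i. \<bar>w x i\<bar>" "{i}"] ell1[OF w that] by (simp add: ell1_def)
        then show ?thesis using w_sum that by force
      qed
      then have conc: "concentrated ?M f \<alpha> ((1/2) ^ k) (\<lambda>x i. v x i - \<delta> * w x i)"
        using C w_nonneg by (intro *[OF dominated_C_ell1[OF K w] C(1) _ _ wC]) auto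
      \<comment> \<open>Elements of \<open>C_ell1 K\<close> are extensional, hence the restriction;
        the integrals see only \<open>K\<close>.\<close>
      define v' where "v' = (\<lambda>x\<in>K. \<lambda>i. v x i - \<delta> * w x i)"
      have v': "v' \<in> ?C" unfolding v'_def by (rule diff_in_C_ell1[OF K v w])
      have "value_of ?M v' t = value_of ?M (\<lambda>x i. v x i - \<delta> * w x i) t" for t
        unfolding value_of_def by (intro Bochner_Integration.integral_cong) (auto simp: v'_def)
      then have "v' \<in> U k" using conc v' by (simp add: U_def concentrated_def)
      moreover have "?d v v' \<le> \<delta>"
        unfolding C_ell1_def
      proof (rule mdist_cfunspace_le)
        fix x assume "x \<in> topspace (top_of_set K)"
        then have x: "x \<in> K" by simp
        \<comment> \<open>The bound 1 on the l1 norm of \<open>w\<close> pays off here: the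
          perturbation has supremum distance at most \<open>\<delta>\<close>.\<close>
        have "ell1_dist (v x) (v' x) = (\<Sum>i. \<delta> * \<bar>w x i\<bar>)"
          using ell1[OF v x] ell1[OF v' x] x \<delta> by (simp add: ell1_dist_def v'_def abs_mult)
        also have "\<dots> = \<delta> * (\<Sum>i. \<bar>w x i\<bar>)"
          using ell1[OF w x] by (intro suminf_mult) (simp add: ell1_def)
        also have "\<dots> \<le> \<delta>" using w_sum x \<delta> by simp
        finally show "mdist ell1_metric (v x) (v' x) \<le> \<delta>" by simp
      qed (use \<delta> in simp)
      ultimately show ?thesis using v v' by auto
    qed
    then show ?thesis unfolding C.metric_closure_of_alt by blast
  qed
  moreover have "?C \<inter> \<Inter>(range U) \<subseteq> unique_solvable K f \<alpha>"
    using unique_solvable_of_concentrated[OF K f ne] by (auto simp: U_def)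
  moreover have "unique_solvable K f \<alpha> \<subseteq> ?C" by (auto simp: unique_solvable_def)
  ultimately show ?thesis
    unfolding residual_in_def by (simp add: mtopology_of_def) (intro exI[of _ "range U"], auto)
qed

lemma minimizers_bang_bang:
  fixes K :: "'a::euclidean_space set" and f :: "nat \<Rightarrow> 'a \<Rightarrow> 'b::euclidean_space"
  assumes K: "compact K" and f: "dominated (lebesgue_on K) f" and ne: "feasible (lebesgue_on K) f \<alpha> \<noteq> {}"
    and v: "v \<in> unique_solvable K f \<alpha>" and \<theta>: "\<theta> \<in> minimizers K f \<alpha> v"
  shows "AE x in lebesgue_on K. \<forall>i. apply_bcontfun (\<theta> x) i \<in> {0, 1}"
proof -
  let ?M = "lebesgue_on K"
  interpret relaxed_problem ?M f \<alpha> by (rule relaxed_problem_lebesgue_on[OF K f ne])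
  have vC: "v \<in> mspace (C_ell1 K)" using v by (simp add: unique_solvable_def)
  note dv = dominated_C_ell1[OF K vC]
  have \<theta>A: "\<theta> \<in> admissible K f \<alpha>" using \<theta> by (simp add: minimizers_def)
  obtain t where t: "t \<in> Adm" "AE x in ?M. apply_bcontfun (\<theta> x) = t x"
    using admissible_imp_feasible[OF f \<theta>A] by blast
  have c: "cost K v \<theta> = value_of ?M v t"
    by (rule cost_eq_value_of[OF Linf_ellinf_of_admissible[OF \<theta>A] Adm_simplex_fields[OF t(1)] t(2) dv])
  obtain \<iota> where \<iota>: "pure \<iota> \<in> Adm" "value_of ?M v (pure \<iota>) = value_of ?M v t"
    using exists_pure_same_value[OF dv t(1)] by blast
  define \<theta>' where "\<theta>' x = Bcontfun (pure \<iota> x)" for x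
  have "\<theta>' \<in> admissible K f \<alpha>" unfolding \<theta>'_def by (rule feasible_imp_admissible[OF f \<iota>(1)])
  moreover have "cost K v \<theta>' = cost K v \<theta>"
    unfolding \<theta>'_def c \<iota>(2)[symmetric] by (rule cost_Bcontfun[OF Adm_simplex_fields[OF \<iota>(1)] dv])
  ultimately have "\<theta>' \<in> minimizers K f \<alpha> v" using \<theta> by (simp add: minimizers_def)
  then obtain \<theta>0 where "AE x in ?M. \<theta>' x = \<theta>0 x" "AE x in ?M. \<theta> x = \<theta>0 x"
    using v \<theta> unfolding unique_solvable_def by blast
  then show ?thesis
  proof eventually_elim
    case (elim x)
    then have "\<theta> x = Bcontfun (vertex (\<iota> x))" by (simp add: \<theta>'_def pure_def)
    then show ?case by (simp add: apply_Bcontfun_simplex_seq vertex_in_simplex_seq) (simp add: vertex_def)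
  qed
qed

text \<open>Allows \<open>f\<close> to be replaced by a version with a finite supremum at every
  point.\<close>

lemma admissible_cong_AE:
  fixes f f' :: "nat \<Rightarrow> 'a::euclidean_space \<Rightarrow> 'b::euclidean_space"
  assumes f: "\<And>i. f i \<in> borel_measurable (lebesgue_on K)" and f': "\<And>i. f' i \<in> borel_measurable (lebesgue_on K)"
    and AE: "AE x in lebesgue_on K. \<forall>i. f i x = f' i x"
  shows "admissible K f \<alpha> = admissible K f' \<alpha>"
proof -
  have "(LINT x|lebesgue_on K. (\<Sum>i. apply_bcontfun (\<theta> x) i *\<^sub>R f i x)) =
      (LINT x|lebesgue_on K. (\<Sum>i. apply_bcontfun (\<theta> x) i *\<^sub>R f' i x))"
    if "\<theta> \<in> borel_measurable (lebesgue_on K)" for \<theta>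
  proof (rule integral_cong_AE)
    have [measurable]: "(\<lambda>x. apply_bcontfun (\<theta> x) i) \<in> borel_measurable (lebesgue_on K)"
      "f i \<in> borel_measurable (lebesgue_on K)" "f' i \<in> borel_measurable (lebesgue_on K)" for i
      using borel_measurable_apply_bcontfun[OF that] f f' by auto
    show "(\<lambda>x. \<Sum>i. apply_bcontfun (\<theta> x) i *\<^sub>R f i x) \<in> borel_measurable (lebesgue_on K)" by measurable
    show "(\<lambda>x. \<Sum>i. apply_bcontfun (\<theta> x) i *\<^sub>R f' i x) \<in> borel_measurable (lebesgue_on K)" by measurable
  qed (use AE in \<open>auto elim: eventually_mono\<close>)
  then show ?thesis by (auto simp: admissible_def Linf_ellinf_def)
qed

theorem theorem2:
  fixes K :: "(real ^ 'd) set"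
    and f :: "nat \<Rightarrow> real ^ 'd \<Rightarrow> real ^ 'n"
    and \<theta>bar :: "nat \<Rightarrow> real ^ 'd \<Rightarrow> real"
    and \<alpha> :: "real ^ 'n"
  assumes "compact K"
    and "\<And>i. integrable (lebesgue_on K) (f i)"
    and "(\<integral>\<^sup>+ x. (SUP i. ennreal (norm (f i x))) \<partial>lebesgue_on K) < \<infinity>"
    and "\<And>i. \<theta>bar i \<in> borel_measurable (lebesgue_on K)"
    and "\<And>i x. x \<in> K \<Longrightarrow> 0 \<le> \<theta>bar i x"
    and "\<And>x. x \<in> K \<Longrightarrow> (\<lambda>i. \<theta>bar i x) sums 1"
    and "\<alpha> = (LINT x|lebesgue_on K. (\<Sum>i. \<theta>bar i x *\<^sub>R f i x))"
  shows "residual_in (mtopology_of (C_ell1 K)) (unique_solvable K f \<alpha>) \<and>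
    (\<forall>v \<in> unique_solvable K f \<alpha>. \<forall>\<theta> \<in> minimizers K f \<alpha> v.
       AE x in lebesgue_on K. \<forall>i. \<theta> x i \<in> {0, 1})"
proof -
  let ?M = "lebesgue_on K"
  have f[measurable]: "f i \<in> borel_measurable ?M" for i using assms(2) by simp
  have [measurable]: "\<theta>bar i \<in> borel_measurable ?M" for i by (rule assms(4))
  define S where "S x = (SUP i. ennreal (norm (f i x)))" for x
  have S[measurable]: "S \<in> borel_measurable ?M" unfolding S_def by measurable
  have fin: "AE x in ?M. S x \<noteq> \<infinity>"
    using assms(3) by (intro nn_integral_noteq_infinite S) (auto simp: S_def)
  \<comment> \<open>the supremum may be infinite on a null set, so the domination holds only after modification there\<close>
  define g where "g i x = (if S x = \<infinity> then 0 else f i x)" for i x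
  have g[measurable]: "g i \<in> borel_measurable ?M" for i unfolding g_def by measurable
  have AE_eq: "AE x in ?M. \<forall>i. f i x = g i x" using fin by eventually_elim (simp add: g_def)
  have dom: "dominated ?M g"
    unfolding dominated_def
  proof (intro conjI allI exI[of _ "\<lambda>x. enn2real (S x)"] ballI g)
    show "integrable ?M (\<lambda>x. enn2real (S x))"
    proof (rule integrableI_bounded)
      have "(\<integral>\<^sup>+x. ennreal (norm (enn2real (S x))) \<partial>?M) \<le> (\<integral>\<^sup>+x. S x \<partial>?M)"
        by (intro nn_integral_mono) (simp add: ennreal_enn2real_if)
      then show "(\<integral>\<^sup>+x. ennreal (norm (enn2real (S x))) \<partial>?M) < \<infinity>"
        using assms(3) by (simp add: S_def)
    qed measurable
    show "norm (g i x) \<le> enn2real (S x)" for i x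
    proof (cases "S x = \<infinity>")
      case False
      have "ennreal (norm (f i x)) \<le> S x" unfolding S_def by (rule SUP_upper) simp
      then have "enn2real (ennreal (norm (f i x))) \<le> enn2real (S x)"
        using False by (intro enn2real_mono) (auto simp: less_top)
      then show ?thesis using False by (simp add: g_def)
    qed (simp add: g_def)
  qed
  have adm: "admissible K f \<alpha> = admissible K g \<alpha>" by (rule admissible_cong_AE[OF f g AE_eq])
  then have min: "minimizers K f \<alpha> = minimizers K g \<alpha>" by (auto simp: minimizers_def fun_eq_iff)
  then have uniq: "unique_solvable K f \<alpha> = unique_solvable K g \<alpha>" by (simp add: unique_solvable_def)
  \<comment> \<open>The given family makes the problem feasible, so the infimum of the costs is
    taken over a nonempty set.\<close>
  have "(\<lambda>x i. \<theta>bar i x) \<in> feasible ?M g \<alpha>"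
  proof -
    have "(LINT x|?M. bary (\<lambda>i. \<theta>bar i x) (\<lambda>i. g i x)) = \<alpha>"
      unfolding assms(7) bary_def
    proof (rule integral_cong_AE)
      show "(\<lambda>x. \<Sum>i. \<theta>bar i x *\<^sub>R g i x) \<in> borel_measurable ?M" by measurable
      show "(\<lambda>x. \<Sum>i. \<theta>bar i x *\<^sub>R f i x) \<in> borel_measurable ?M" by measurable
      show "AE x in ?M. (\<Sum>i. \<theta>bar i x *\<^sub>R g i x) = (\<Sum>i. \<theta>bar i x *\<^sub>R f i x)"
        using AE_eq by eventually_elim simp
    qed
    moreover have "(\<lambda>x i. \<theta>bar i x) \<in> simplex_fields ?M"
      unfolding simplex_fields_def simplex_seq_def using assms(4-6)
      by (intro CollectI conjI allI ballI) auto
    ultimately show ?thesis unfolding feasible_def by blast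
  qed
  then have ne: "feasible ?M g \<alpha> \<noteq> {}" by blast
  show ?thesis
    unfolding uniq min
    using residual_unique_solvable[OF assms(1) dom ne] minimizers_bang_bang[OF assms(1) dom ne] by blast
qed

end
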